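(* Let $d,m,n$ be positive integers, let $\alpha\in(0,1)$, and let $C_\alpha>0$ be the constant, depending only on $\alpha$, defined in the context. Suppose that $\rho>0$ satisfies $$\rho^2 \ge C_\alpha\,\frac{\sqrt{d\,(m\wedge d)}}{n}.$$ Then there exists a distributed (1-bit, public coin) test $T\in\mathcal{T}_{dist}$ such that $$\mathcal{R}(H_\rho,T)\le\alpha .$$
   Context: Notation: $a\wedge b=\min\{a,b\}$; $\|\cdot\|$ is the Euclidean norm. Model: there are $m$ machines. For $\mu\in\mathbb{R}^d$, machine $j\in\{1,\dots,m\}$ observes $X^{(j)}=\mu+\sqrt{m/n}\,Z^{(j)}$, where $Z^{(1)},\dots,Z^{(m)}$ are independent $N_d(0,I_d)$ vectors. One tests $H_0:\mu=0$ against $H_\rho:\|\mu\|\ge\rho$. Distributed tests: a distributed test consists of a public coin, i.e. a random vector $U$ (with arbitrary distribution, chosen as part of the test and not depending on $\mu$) which is independent of $(X^{(1)},\dots,X^{(m)})$ and available to all machines; local outcomes $T^{(j)}\in\{0,1\}$, $j=1,\dots,m$, where $T^{(j)}$ is generated by machine $j$ from $(X^{(j)},U)$ only (possibly with local randomization, i.e. $T^{(j)}$ is drawn from a Markov kernel given $(X^{(j)},U)$, independently across machines conditionally on $(X^{(1)},\dots,X^{(m)},U)$); and a final decision $T\in\{0,1\}$ that is a function of $(T^{(1)},\dots,T^{(m)})$. The collection of all such tests $T$ is $\mathcal{T}_{dist}$. Risk: with $P_\mu$ the underlying probability distribution (of data, public coin and local randomization) when $\mu$ is the true signal, $$\mathcal{R}(H_\rho,T)=P_0(T=1)+\sup_{\|\mu\|\ge\rho}P_\mu(T=0).$$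 Constants: put $\bar\kappa_\alpha^2=3\log(4/\alpha)$, $\tilde\kappa_\alpha^2=\tfrac13\log(16/\alpha)$, $\kappa_\alpha^2=4/\alpha$ (all $\kappa$'s positive), and $$M_\alpha=\max\left\{(2^5\cdot 5\,\bar\kappa_\alpha)^2,\ \bar D,\ 36\tilde\kappa_\alpha^2,\ 4e^2\pi\tilde\kappa_\alpha^2\alpha^{1/2}\right\},$$ $$C_\alpha=\max\left\{2^4M_\alpha^2\kappa_\alpha^2,\ 2(1+\sqrt2)\kappa_\alpha M_\alpha,\ 80\bar\kappa_\alpha,\ 2^{12}e^2\tilde\kappa_\alpha^2\alpha^{-5/2}\right\}.$$ Here $\bar D\in\mathbb{N}$ is a universal integer (it exists) with the property that for all $d\ge\bar D$ and all $\delta>0$, if $U_d\sim\chi^2_d$ (central) and $V_d^\delta\sim\chi^2_d(\delta)$ (noncentral chi-square with $d$ degrees of freedom and noncentrality parameter $\delta$) are independent, then $\Pr(V_d^\delta-U_d\ge0)\ge\frac12+\frac1{40}\left(\frac{\delta}{\sqrt d}\wedge\frac12\right)$. *)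

theory Defs
  imports "HOL-Probability.Probability"
begin

definition std_gaussian :: "(real ^ 'd) measure" where
  "std_gaussian = distr (\<Pi>\<^sub>M i\<in>(UNIV :: 'd set). std_normal_distribution) borel (\<lambda>z. \<chi> i. z i)"

text \<open>Joint law of \<open>X j = \<mu> + sqrt (m / n) Z j\<close> for \<open>j < m\<close>; machines are indexed by \<open>0, \<dots>, m - 1\<close>.\<close>

definition data_law :: "nat \<Rightarrow> nat \<Rightarrow> real ^ 'd \<Rightarrow> (nat \<Rightarrow> real ^ 'd) measure" where
  "data_law m n \<mu> =
     (\<Pi>\<^sub>M j\<in>{..<m}. distr std_gaussian borel (\<lambda>z. \<mu> + sqrt (real m / real n) *\<^sub>R z))"

abbreviation coin_space :: "nat \<Rightarrow> (nat \<Rightarrow> real) measure" where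
  "coin_space k \<equiv> (\<Pi>\<^sub>M i\<in>{..<k}. borel)"

abbreviation bits_space :: "nat \<Rightarrow> (nat \<Rightarrow> bool) measure" where
  "bits_space m \<equiv> (\<Pi>\<^sub>M j\<in>{..<m}. count_space UNIV)"

text \<open>
  The public coin is a random vector of some dimension \<open>coin_dim\<close> with an arbitrary law
  \<open>coin_law\<close>. Machine \<open>j\<close> draws its bit from \<open>local_kernel j (x, u)\<close> when it observes \<open>x\<close> and
  the coin shows \<open>u\<close>. Bit strings are elements of \<open>bits_space m\<close>, hence undefined at all
  indices from \<open>m\<close> on, so that \<open>decision\<close> has access to nothing but the \<open>m\<close> bits.
\<close>

record 'd dist_test =
  coin_dim :: nat
  coin_law :: "(nat \<Rightarrow> real) measure"
  local_kernel :: "nat \<Rightarrow> (real ^ 'd) \<times> (nat \<Rightarrow> real) \<Rightarrow> bool measure"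
  decision :: "(nat \<Rightarrow> bool) \<Rightarrow> bool"

definition distributed_tests :: "nat \<Rightarrow> ('d::finite) dist_test set" where
  "distributed_tests m =
     {T. coin_law T \<in> space (prob_algebra (coin_space (coin_dim T))) \<and>
         (\<forall>j<m. local_kernel T j
            \<in> borel \<Otimes>\<^sub>M coin_space (coin_dim T) \<rightarrow>\<^sub>M prob_algebra (count_space UNIV))}"

definition local_bits ::
    "nat \<Rightarrow> ('d::finite) dist_test \<Rightarrow> (nat \<Rightarrow> real ^ 'd) \<times> (nat \<Rightarrow> real) \<Rightarrow> (nat \<Rightarrow> bool) measure" where
  "local_bits m T = (\<lambda>(x, u). \<Pi>\<^sub>M j\<in>{..<m}. local_kernel T j (x j, u))"

text \<open>Law of the bits under \<open>P\<^sub>\<mu>\<close>; data and coin are independent, and the bits are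
  conditionally independent given both.\<close>

definition bits_law ::
    "nat \<Rightarrow> nat \<Rightarrow> ('d::finite) dist_test \<Rightarrow> real ^ 'd \<Rightarrow> (nat \<Rightarrow> bool) measure" where
  "bits_law m n T \<mu> = (data_law m n \<mu> \<Otimes>\<^sub>M coin_law T) \<bind> local_bits m T"

definition prob_decision ::
    "nat \<Rightarrow> nat \<Rightarrow> ('d::finite) dist_test \<Rightarrow> real ^ 'd \<Rightarrow> bool \<Rightarrow> real" where
  "prob_decision m n T \<mu> b =
     measure (bits_law m n T \<mu>) {t \<in> space (bits_law m n T \<mu>). decision T t = b}"

definition test_risk :: "nat \<Rightarrow> nat \<Rightarrow> real \<Rightarrow> ('d::finite) dist_test \<Rightarrow> real" where
  "test_risk m n \<rho> T =
     prob_decision m n T 0 True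
     + (SUP \<mu>\<in>{\<mu> :: real ^ 'd. norm \<mu> \<ge> \<rho>}. prob_decision m n T \<mu> False)"

text \<open>The following lemmas show that \<open>bits_law\<close> is a probability measure on \<open>bits_space m\<close>, so the
  Giry-monad \<open>\<bind>\<close> is used within its domain and the supremum in \<open>test_risk\<close> is over a bounded set.\<close>

lemma prob_space_std_gaussian: "prob_space (std_gaussian :: (real ^ 'd::finite) measure)"
  and sets_std_gaussian: "sets (std_gaussian :: (real ^ 'd) measure) = sets borel"
proof -
  interpret prob_space "\<Pi>\<^sub>M i\<in>(UNIV :: 'd set). std_normal_distribution"
    by (intro prob_space_PiM real_dist_normal_dist[THEN real_distribution.axioms(1)])
  have "(\<lambda>z. \<chi> i. z i) \<in> (\<Pi>\<^sub>M i\<in>(UNIV :: 'd set). std_normal_distribution) \<rightarrow>\<^sub>M (borel :: (real ^ 'd) measure)"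
  proof (rule borel_measurable_euclidean_space[THEN iffD2], intro ballI)
    fix b :: "real ^ 'd" assume "b \<in> Basis"
    then obtain i where "b = axis i 1" by (auto simp: Basis_vec_def)
    then show "(\<lambda>z. (\<chi> i. z i) \<bullet> b) \<in> borel_measurable (\<Pi>\<^sub>M i\<in>(UNIV :: 'd set). std_normal_distribution)"
      using measurable_component_singleton[of i UNIV "\<lambda>_::'d. std_normal_distribution"]
      by (simp add: inner_axis)
  qed
  then show "prob_space (std_gaussian :: (real ^ 'd) measure)"
    unfolding std_gaussian_def by (rule prob_space_distr)
qed (simp add: std_gaussian_def)

lemma data_law_prob_algebra:
  "data_law m n (\<mu> :: real ^ 'd::finite) \<in> space (prob_algebra (\<Pi>\<^sub>M j\<in>{..<m}. borel))"
proof -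
  let ?N = "distr std_gaussian borel (\<lambda>z. \<mu> + sqrt (real m / real n) *\<^sub>R z)"
  have "(\<lambda>z. \<mu> + sqrt (real m / real n) *\<^sub>R z) \<in> std_gaussian \<rightarrow>\<^sub>M borel"
    by (simp add: measurable_cong_sets[OF sets_std_gaussian refl])
  then have "prob_space ?N"
    by (rule prob_space.prob_space_distr[OF prob_space_std_gaussian])
  then show ?thesis
    unfolding data_law_def space_prob_algebra
    by (intro CollectI conjI prob_space_PiM sets_PiM_cong) simp_all
qed

lemma local_bits_measurable:
  assumes "T \<in> distributed_tests m"
  shows "local_bits m (T :: 'd::finite dist_test)
    \<in> (\<Pi>\<^sub>M j\<in>{..<m}. borel) \<Otimes>\<^sub>M coin_space (coin_dim T) \<rightarrow>\<^sub>M prob_algebra (bits_space m)"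
proof -
  let ?D = "(\<Pi>\<^sub>M j\<in>{..<m}. borel) \<Otimes>\<^sub>M coin_space (coin_dim T)
     :: ((nat \<Rightarrow> real ^ 'd) \<times> (nat \<Rightarrow> real)) measure"
  have K: "(\<lambda>(x, u). local_kernel T j (x j, u)) \<in> ?D \<rightarrow>\<^sub>M prob_algebra (count_space UNIV)"
    if "j < m" for j
  proof -
    have [measurable]: "local_kernel T j
       \<in> borel \<Otimes>\<^sub>M coin_space (coin_dim T) \<rightarrow>\<^sub>M prob_algebra (count_space UNIV)"
      using assms that by (auto simp: distributed_tests_def)
    have [measurable]: "j \<in> {..<m}" using that by simp
    show ?thesis by measurable
  qed
  have prob: "prob_space (local_kernel T j (x j, u))"
    and sets_K: "sets (local_kernel T j (x j, u)) = sets (count_space UNIV)"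
    if "(x, u) \<in> space ?D" "j < m" for x u j
    using measurable_space[OF K[OF that(2)] that(1)] by (auto simp: space_prob_algebra)
  have space_K: "space (local_kernel T j (x j, u)) = UNIV"
    if "(x, u) \<in> space ?D" "j < m" for x u j
    using sets_eq_imp_space_eq[OF sets_K[OF that]] by simp
  have set_eq: "sets (bits_space m) =
     sigma_sets (\<Pi>\<^sub>E j\<in>{..<m}. UNIV) {\<Pi>\<^sub>E j\<in>{..<m}. E j |E. True}"
    unfolding sets_PiM by (subst prod_algebra_eq_finite) (simp_all add: Pi_iff)
  show ?thesis
  proof (rule measurable_prob_algebra_generated[OF set_eq])
    show "Int_stable {\<Pi>\<^sub>E j\<in>{..<m}. E j |E :: nat \<Rightarrow> bool set. True}"
      unfolding Int_stable_def by clarify (subst PiE_Int, blast)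
    show "{\<Pi>\<^sub>E j\<in>{..<m}. E j |E :: nat \<Rightarrow> bool set. True} \<subseteq> Pow (\<Pi>\<^sub>E j\<in>{..<m}. UNIV)"
      by blast
  next
    fix a assume a: "a \<in> space ?D"
    obtain x u where xu: "a = (x, u)" by (cases a)
    show "prob_space (local_bits m T a)"
      unfolding local_bits_def xu prod.case using a xu by (intro prob_space_PiM prob) simp_all
    show "sets (local_bits m T a) = sets (bits_space m)"
      unfolding local_bits_def xu prod.case using a xu by (intro sets_PiM_cong sets_K) simp_all
  next
    fix A :: "(nat \<Rightarrow> bool) set" assume "A \<in> {\<Pi>\<^sub>E j\<in>{..<m}. E j |E. True}"
    then obtain E where A: "A = (\<Pi>\<^sub>E j\<in>{..<m}. E j)" by blast
    have "emeasure (local_bits m T (x, u)) A = (\<Prod>j<m. emeasure (local_kernel T j (x j, u)) (E j))"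
      if *: "(x, u) \<in> space ?D" for x u
    proof -
      let ?M = "\<lambda>j. if j < m then local_kernel T j (x j, u) else return (count_space UNIV) True"
      interpret product_prob_space ?M "{..<m}"
        by (intro product_prob_spaceI) (auto intro!: prob[OF *] prob_space_return)
      have "local_bits m T (x, u) = PiM {..<m} ?M"
        unfolding local_bits_def prod.case by (intro PiM_cong) simp_all
      moreover have "emeasure (PiM {..<m} ?M) A = (\<Prod>j<m. emeasure (?M j) (E j))"
        unfolding A using sets_K[OF *] by (intro emeasure_PiM) auto
      ultimately show ?thesis by simp
    qed
    then have eq: "emeasure (local_bits m T a) A =
        (\<Prod>j<m. emeasure ((\<lambda>(x, u). local_kernel T j (x j, u)) a) (E j))" if "a \<in> space ?D" for a
      using that by (cases a) auto
    have "(\<lambda>a. \<Prod>j<m. emeasure ((\<lambda>(x, u). local_kernel T j (x j, u)) a) (E j)) \<in> borel_measurable ?D"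
    proof (intro borel_measurable_prod_ennreal)
      fix j assume "j \<in> {..<m}"
      then have "(\<lambda>(x, u). local_kernel T j (x j, u)) \<in> ?D \<rightarrow>\<^sub>M subprob_algebra (count_space UNIV)"
        using K by (intro measurable_prob_algebraD) simp
      then show "(\<lambda>a. emeasure ((\<lambda>(x, u). local_kernel T j (x j, u)) a) (E j)) \<in> borel_measurable ?D"
        by (rule measurable_emeasure_kernel) simp
    qed
    then show "(\<lambda>a. emeasure (local_bits m T a) A) \<in> borel_measurable ?D"
      by (subst measurable_cong[OF eq])
  qed
qed

lemma bits_law_prob_algebra:
  assumes "T \<in> distributed_tests m"
  shows "bits_law m n T \<mu> \<in> space (prob_algebra (bits_space m))"
proof -
  let ?D = "data_law m n \<mu>" and ?C = "coin_law T"
  have D: "prob_space ?D" "sets ?D = sets (\<Pi>\<^sub>M j\<in>{..<m}. borel)"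
    using data_law_prob_algebra[of m n \<mu>] by (auto simp: space_prob_algebra)
  have C: "prob_space ?C" "sets ?C = sets (coin_space (coin_dim T))"
    using assms by (auto simp: space_prob_algebra distributed_tests_def)
  interpret D: prob_space ?D by fact
  interpret C: prob_space ?C by fact
  interpret DC: pair_prob_space ?D ?C ..
  have "?D \<Otimes>\<^sub>M ?C \<in> space (prob_algebra ((\<Pi>\<^sub>M j\<in>{..<m}. borel) \<Otimes>\<^sub>M coin_space (coin_dim T)))"
    using DC.prob_space_axioms D C by (auto simp: space_prob_algebra intro!: sets_pair_measure_cong)
  then show ?thesis
    unfolding bits_law_def
    using prob_space_bind'[OF _ local_bits_measurable[OF assms]]
          sets_bind'[OF _ local_bits_measurable[OF assms]]
    by (auto simp: space_prob_algebra)
qed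

text \<open>The law of \<open>\<parallel>Z + \<theta>\<parallel>\<^sup>2\<close> depends on \<open>\<theta>\<close> through \<open>\<parallel>\<theta>\<parallel>\<^sup>2 = \<delta>\<close> only; the shift is put on the
  first coordinate. Only used for \<open>d > 0\<close> and \<open>\<delta> \<ge> 0\<close>.\<close>

definition noncentral_chi_square :: "nat \<Rightarrow> real \<Rightarrow> real measure" where
  "noncentral_chi_square d \<delta> =
     distr (\<Pi>\<^sub>M i\<in>{..<d}. std_normal_distribution) borel
       (\<lambda>z. \<Sum>i<d. (z i + (if i = 0 then sqrt \<delta> else 0))\<^sup>2)"

definition chi_square_gap :: "nat \<Rightarrow> bool" where
  "chi_square_gap D \<longleftrightarrow> 0 < D \<and>
     (\<forall>d\<ge>D. \<forall>\<delta>>0.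
        measure (noncentral_chi_square d \<delta> \<Otimes>\<^sub>M noncentral_chi_square d 0) {(v, u). v - u \<ge> 0}
          \<ge> 1/2 + 1/40 * min (\<delta> / sqrt (real d)) (1/2))"

text \<open>Any \<open>D\<close> with \<open>chi_square_gap D\<close> could serve here. The constant \<open>C_const\<close> below is
  nondecreasing in it, so the least one gives the weakest signal strength condition.\<close>

definition D_bar :: nat where
  "D_bar = (LEAST D. chi_square_gap D)"

definition kappa_bar :: "real \<Rightarrow> real" where
  "kappa_bar \<alpha> = sqrt (3 * ln (4 / \<alpha>))"

definition kappa_tilde :: "real \<Rightarrow> real" where
  "kappa_tilde \<alpha> = sqrt (1/3 * ln (16 / \<alpha>))"

definition kappa :: "real \<Rightarrow> real" where
  "kappa \<alpha> = sqrt (4 / \<alpha>)"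

definition M_const :: "real \<Rightarrow> real" where
  "M_const \<alpha> = Max {(2^5 * 5 * kappa_bar \<alpha>)\<^sup>2,
                     real D_bar,
                     36 * (kappa_tilde \<alpha>)\<^sup>2,
                     4 * (exp 1)\<^sup>2 * pi * (kappa_tilde \<alpha>)\<^sup>2 * \<alpha> powr (1/2)}"

definition C_const :: "real \<Rightarrow> real" where
  "C_const \<alpha> = Max {2^4 * (M_const \<alpha>)\<^sup>2 * (kappa \<alpha>)\<^sup>2,
                     2 * (1 + sqrt 2) * kappa \<alpha> * M_const \<alpha>,
                     80 * kappa_bar \<alpha>,
                     2^12 * (exp 1)\<^sup>2 * (kappa_tilde \<alpha>)\<^sup>2 * \<alpha> powr (-5/2)}"

end

theory Submission
  imports Defs
begin

text \<open>
  Put \<open>\<theta> = sqrt (n / m) \<mu>\<close>, so that after rescaling machine \<open>j\<close> observes \<open>\<theta> + Z j\<close>. If all machines use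
  the same kernel, then given the coin \<open>u\<close> the bits are i.i.d. Bernoulli with some mean \<open>q \<mu> u\<close>, and
  rejecting when the number of ones is far from its null expectation succeeds, by Hoeffding's inequality,
  as soon as \<open>\<bar>q \<mu> u - q 0 u\<bar>\<close> exceeds a multiple of \<open>sqrt (ln (16 / \<alpha>) / m)\<close> with high coin probability.

  For \<open>m \<ge> d\<close> the coin is a Gaussian direction \<open>u\<close> and a machine reports the sign of \<open>u \<bullet> x\<close>; the shift is of
  order \<open>\<bar>u \<bullet> \<theta>\<bar> / \<parallel>u\<parallel>\<close>, and \<open>u \<bullet> \<theta>\<close> is Gaussian, hence rarely near \<open>0\<close>. For \<open>m < d\<close> no coin is needed: a
  machine reports a randomized bit whose mean is affine in the clipped energy
  \<open>(\<parallel>x\<parallel>\<^sup>2 - d) / sqrt d\<close>. Since \<open>\<parallel>\<theta>\<parallel> \<ge> 1\<close> in this regime, clipping costs only a fraction of the shift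
  \<open>\<parallel>\<theta>\<parallel>\<^sup>2 / sqrt d\<close> of the energy; this requires second moments only and replaces the anticoncentration of
  chi-square differences. If \<open>m\<close> is at most a multiple of
  \<open>ln (16 / \<alpha>)\<close>, one machine alone can threshold its energy, by Chebyshev's inequality.
\<close>

section \<open>Tests with a common kernel\<close>

abbreviation iid_bits :: "nat \<Rightarrow> real \<Rightarrow> (nat \<Rightarrow> bool) measure" where
  "iid_bits m p \<equiv> \<Pi>\<^sub>M j\<in>{..<m}. measure_pmf (bernoulli_pmf p)"

text \<open>A bit string is a box with one-point sides and there are only finitely many strings, so
  every rejection region is an event, whatever the decision function is.\<close>

lemma sets_bernoulli_product:
  "sets (\<Pi>\<^sub>M j\<in>{..<m :: nat}. measure_pmf (bernoulli_pmf (p j))) = Pow (\<Pi>\<^sub>E j\<in>{..<m}. UNIV)"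
proof
  show "sets (\<Pi>\<^sub>M j\<in>{..<m}. measure_pmf (bernoulli_pmf (p j))) \<subseteq> Pow (\<Pi>\<^sub>E j\<in>{..<m}. UNIV)"
    using sets.space_closed[of "\<Pi>\<^sub>M j\<in>{..<m}. measure_pmf (bernoulli_pmf (p j))"]
    by (simp add: space_PiM)
next
  show "Pow (\<Pi>\<^sub>E j\<in>{..<m}. UNIV) \<subseteq> sets (\<Pi>\<^sub>M j\<in>{..<m}. measure_pmf (bernoulli_pmf (p j)))"
  proof
    fix A :: "(nat \<Rightarrow> bool) set" assume A: "A \<in> Pow (\<Pi>\<^sub>E j\<in>{..<m}. UNIV)"
    then have "finite A"
      by (meson PowD finite finite_PiE finite_lessThan finite_subset)
    moreover have "{t} \<in> sets (\<Pi>\<^sub>M j\<in>{..<m}. measure_pmf (bernoulli_pmf (p j)))" if "t \<in> A" for t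
    proof -
      have "{t} = (\<Pi>\<^sub>E j\<in>{..<m}. {t j})"
        using A that by (intro PiE_singleton[symmetric]) (auto simp: PiE_def)
      also have "\<dots> \<in> sets (\<Pi>\<^sub>M j\<in>{..<m}. measure_pmf (bernoulli_pmf (p j)))"
        by (intro sets_PiM_I_finite) auto
      finally show ?thesis .
    qed
    ultimately have "(\<Union>t\<in>A. {t}) \<in> sets (\<Pi>\<^sub>M j\<in>{..<m}. measure_pmf (bernoulli_pmf (p j)))"
      by (intro sets.finite_UN) auto
    then show "A \<in> sets (\<Pi>\<^sub>M j\<in>{..<m}. measure_pmf (bernoulli_pmf (p j)))" by simp
  qed
qed

lemma prob_space_iid_bits: "prob_space (iid_bits m p)"
  by (intro prob_space_PiM prob_space_measure_pmf)

text \<open>Additivity over finitely many strings gives a finite sum of products, from which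
  measurability in the parameters and factorization of integrals can be read off term by
  term.\<close>

lemma emeasure_bernoulli_product:
  fixes m :: nat
  assumes A: "A \<subseteq> (\<Pi>\<^sub>E j\<in>{..<m}. UNIV)"
  shows "emeasure (\<Pi>\<^sub>M j\<in>{..<m}. measure_pmf (bernoulli_pmf (p j))) A =
    (\<Sum>t\<in>A. \<Prod>j<m. ennreal (pmf (bernoulli_pmf (p j)) (t j)))"
proof -
  interpret product_prob_space "\<lambda>j. measure_pmf (bernoulli_pmf (p j))" "{..<m}"
    by (intro product_prob_spaceI prob_space_measure_pmf)
  have fin: "finite A"
    using A by (meson finite finite_PiE finite_lessThan finite_subset)
  have "emeasure (\<Pi>\<^sub>M j\<in>{..<m}. measure_pmf (bernoulli_pmf (p j))) A =
      (\<Sum>t\<in>A. emeasure (\<Pi>\<^sub>M j\<in>{..<m}. measure_pmf (bernoulli_pmf (p j))) {t})"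
    using A fin by (intro emeasure_eq_sum_singleton) (auto simp: sets_bernoulli_product)
  also have "\<dots> = (\<Sum>t\<in>A. \<Prod>j<m. ennreal (pmf (bernoulli_pmf (p j)) (t j)))"
  proof (rule sum.cong[OF refl])
    fix t assume "t \<in> A"
    then have "{t} = (\<Pi>\<^sub>E j\<in>{..<m}. {t j})"
      using A by (intro PiE_singleton[symmetric]) (auto simp: PiE_def)
    then show "emeasure (\<Pi>\<^sub>M j\<in>{..<m}. measure_pmf (bernoulli_pmf (p j))) {t} =
        (\<Prod>j<m. ennreal (pmf (bernoulli_pmf (p j)) (t j)))"
      by (simp only:) (subst emeasure_PiM, simp_all add: emeasure_pmf_single)
  qed
  finally show ?thesis .
qed

text \<open>Both point masses, \<open>p\<close> at \<open>True\<close> and \<open>1 - p\<close> at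
  \<open>False\<close>, are affine in the parameter, so the integral passes through to the
  parameter.\<close>

lemma nn_integral_bernoulli_mixture:
  assumes N: "prob_space N"
    and g [measurable]: "g \<in> borel_measurable N" and g01: "\<And>x. g x \<in> {0..1::real}"
  shows "(\<integral>\<^sup>+x. ennreal (pmf (bernoulli_pmf (g x)) b) \<partial>N) =
    ennreal (pmf (bernoulli_pmf (\<integral>x. g x \<partial>N)) b)"
proof -
  interpret prob_space N by fact
  have int: "integrable N g"
    using g01 by (intro integrable_const_bound[where B=1]) auto
  \<comment> \<open>The affine formulas for the point masses hold only for parameters in the unit
    interval, so the averaged parameter must be located there too.\<close>
  have range: "(\<integral>x. g x \<partial>N) \<in> {0..1}"
    using integral_mono[of N "\<lambda>_. 0" g] integral_mono[of N g "\<lambda>_. 1"] int g01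
    by (auto simp: prob_space)
  show ?thesis
  proof (cases b)
    case True
    then show ?thesis
      using g01 range int by (simp add: nn_integral_eq_integral)
  next
    case False
    then show ?thesis
      using g01 range int by (simp add: nn_integral_eq_integral prob_space)
  qed
qed

text \<open>The observations \<open>x j\<close> are independent, hence the probability of each
  string integrates factor by factor. Integrating out the data leaves i.i.d. bits with the averaged
  parameter.\<close>

lemma iid_bits_mixture:
  assumes N: "prob_space N"
    and g [measurable]: "g \<in> borel_measurable N" and g01: "\<And>x. g x \<in> {0..1::real}"
    and A: "A \<subseteq> (\<Pi>\<^sub>E j\<in>{..<m}. UNIV)"
  shows "(\<integral>\<^sup>+x. emeasure (\<Pi>\<^sub>M j\<in>{..<m}. measure_pmf (bernoulli_pmf (g (x j)))) A
      \<partial>(\<Pi>\<^sub>M j\<in>{..<m}. N)) = emeasure (iid_bits m (\<integral>x. g x \<partial>N)) A"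
proof -
  interpret N: product_prob_space "\<lambda>j::nat. N" "{..<m}"
    by (intro product_prob_spaceI N)
  have meas: "(\<lambda>x. ennreal (pmf (bernoulli_pmf (g x)) b)) \<in> borel_measurable N" for b
    using g01 by (cases b) auto
  have "(\<lambda>x. ennreal (pmf (bernoulli_pmf (g (x j))) b)) \<in> borel_measurable (\<Pi>\<^sub>M j\<in>{..<m}. N)"
    if "j < m" for j b
    using that by (intro measurable_compose[OF measurable_component_singleton[of j "{..<m}" "\<lambda>_. N"] meas]) simp
  then have "(\<integral>\<^sup>+x. (\<Sum>t\<in>A. \<Prod>j<m. ennreal (pmf (bernoulli_pmf (g (x j))) (t j))) \<partial>(\<Pi>\<^sub>M j\<in>{..<m}. N)) =
      (\<Sum>t\<in>A. \<integral>\<^sup>+x. (\<Prod>j<m. ennreal (pmf (bernoulli_pmf (g (x j))) (t j))) \<partial>(\<Pi>\<^sub>M j\<in>{..<m}. N))"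
    by (intro nn_integral_sum borel_measurable_prod_ennreal) simp
  also have "\<dots> = (\<Sum>t\<in>A. \<Prod>j<m. \<integral>\<^sup>+x. ennreal (pmf (bernoulli_pmf (g x)) (t j)) \<partial>N)"
    using meas by (intro sum.cong refl N.product_nn_integral_prod) auto
  finally show ?thesis
    unfolding emeasure_bernoulli_product[OF A]
    by (simp only: nn_integral_bernoulli_mixture[OF N g g01])
qed

abbreviation bit_count :: "nat \<Rightarrow> (nat \<Rightarrow> bool) \<Rightarrow> real" where
  "bit_count m t \<equiv> \<Sum>j<m. of_bool (t j)"

text \<open>Hoeffding's inequality for \<open>m\<close> independent variables with values in
  \<open>{0..1}\<close>: the squared ranges add up to \<open>m\<close>, and the mean of the sum is
  \<open>m * p\<close>.\<close>

lemma bit_count_concentration: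
  assumes p: "p \<in> {0..1}" and m: "m > 0" and \<tau>: "\<tau> \<ge> 0"
  shows "measure (iid_bits m p) {t \<in> (\<Pi>\<^sub>E j\<in>{..<m}. UNIV). \<bar>bit_count m t - m * p\<bar> \<ge> \<tau>}
    \<le> 2 * exp (- 2 * \<tau>\<^sup>2 / m)"
proof -
  let ?P = "iid_bits m p"
  interpret prob_space ?P by (rule prob_space_iid_bits)
  have space: "space ?P = (\<Pi>\<^sub>E j\<in>{..<m}. UNIV)" by (simp add: space_PiM)
  have comp: "distr ?P (measure_pmf (bernoulli_pmf p)) (\<lambda>t. t j) = measure_pmf (bernoulli_pmf p)"
    if "j < m" for j
    using that by (intro distr_PiM_component) (auto simp: prob_space_measure_pmf)
  have rv: "random_variable (count_space UNIV) (\<lambda>t. t j)" if "j < m" for j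
    using measurable_component_singleton[of j "{..<m}" "\<lambda>_. measure_pmf (bernoulli_pmf p)"] that
    by simp
  \<comment> \<open>Under a product measure the joint law of the coordinates is the product of their
    marginals, which is the criterion for independence.\<close>
  have "indep_vars (\<lambda>_. measure_pmf (bernoulli_pmf p)) (\<lambda>j t. t j) {..<m}"
  proof (subst indep_vars_iff_distr_eq_PiM')
    have "distr ?P ?P (\<lambda>t. \<lambda>j\<in>{..<m}. t j) = distr ?P ?P (\<lambda>t. t)"
      by (intro distr_cong) (auto simp: space)
    then show "distr ?P ?P (\<lambda>t. \<lambda>j\<in>{..<m}. t j) =
        (\<Pi>\<^sub>M j\<in>{..<m}. distr ?P (measure_pmf (bernoulli_pmf p)) (\<lambda>t. t j))"
      using comp PiM_cong[OF refl, of "{..<m}" "\<lambda>j. distr ?P (measure_pmf (bernoulli_pmf p)) (\<lambda>t. t j)"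
        "\<lambda>_. measure_pmf (bernoulli_pmf p)"] by (simp add: distr_id2)
  qed (use m rv in auto)
  then have indep: "indep_vars (\<lambda>_. borel) (\<lambda>j t. of_bool (t j) :: real) {..<m}"
    by (rule indep_vars_compose2) simp
  have mean: "expectation (\<lambda>t. of_bool (t j) :: real) = p" if "j < m" for j
  proof -
    have "expectation (\<lambda>t. of_bool (t j) :: real) =
        (\<integral>b. of_bool b \<partial>distr ?P (measure_pmf (bernoulli_pmf p)) (\<lambda>t. t j))"
      using rv[OF that] by (subst integral_distr) auto
    also have "\<dots> = p" using p by (simp add: comp[OF that])
    finally show ?thesis .
  qed
  interpret Hoeffding_ineq ?P "{..<m}" "\<lambda>j t. of_bool (t j)" "\<lambda>_. 0" "\<lambda>_. 1" "m * p"
    by unfold_locales (auto simp: indep mean)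
  show ?thesis
    using Hoeffding_ineq_abs_ge[OF \<tau>] m by (simp add: space)
qed

lemma emeasure_iid_bits_mono_le:
  assumes "B \<subseteq> (\<Pi>\<^sub>E j\<in>{..<m}. UNIV)" "A \<subseteq> B" "measure (iid_bits m p) B \<le> c"
  shows "emeasure (iid_bits m p) A \<le> ennreal c"
proof -
  interpret prob_space "iid_bits m p" by (rule prob_space_iid_bits)
  have "measure (iid_bits m p) A \<le> measure (iid_bits m p) B"
    using assms by (intro finite_measure_mono) (auto simp: sets_bernoulli_product)
  with assms(3) show ?thesis
    by (simp add: emeasure_eq_measure ennreal_leI)
qed

text \<open>A real supremum is bounded by a common bound only over a nonempty index set; a vector of
  norm \<open>\<bar>\<rho>\<bar>\<close> supplies an element. The hypotheses are stated in
  \<open>ennreal\<close> because decision probabilities are computed below as nonnegative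
  integrals.\<close>

lemma test_risk_le:
  fixes T :: "'d::finite dist_test"
  assumes "0 \<le> \<epsilon>\<^sub>1" "0 \<le> \<epsilon>\<^sub>2"
    and "ennreal (prob_decision m n T 0 True) \<le> ennreal \<epsilon>\<^sub>1"
    and "\<And>\<mu>. norm \<mu> \<ge> \<rho> \<Longrightarrow> ennreal (prob_decision m n T \<mu> False) \<le> ennreal \<epsilon>\<^sub>2"
  shows "test_risk m n \<rho> T \<le> \<epsilon>\<^sub>1 + \<epsilon>\<^sub>2"
proof -
  obtain \<mu> :: "real ^ 'd" where "norm \<mu> = \<bar>\<rho>\<bar>"
    using vector_choose_size[of "\<bar>\<rho>\<bar>"] by auto
  then have ne: "{\<mu> :: real ^ 'd. norm \<mu> \<ge> \<rho>} \<noteq> {}"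
    by (auto intro!: exI[of _ \<mu>])
  have "prob_decision m n T \<mu> False \<le> \<epsilon>\<^sub>2" if "norm \<mu> \<ge> \<rho>" for \<mu>
    using assms(2) assms(4)[OF that] by simp
  then have "(SUP \<mu>\<in>{\<mu> :: real ^ 'd. norm \<mu> \<ge> \<rho>}. prob_decision m n T \<mu> False) \<le> \<epsilon>\<^sub>2"
    by (intro cSUP_least ne) simp
  moreover have "prob_decision m n T 0 True \<le> \<epsilon>\<^sub>1"
    using assms(1,3) by simp
  ultimately show ?thesis
    unfolding test_risk_def by linarith
qed

section \<open>The Gaussian coin and tests with i.i.d. bits given the coin\<close>

lemma vec_lambda_measurable_std_normal:
  "(\<lambda>z. \<chi> i. z i) \<in> (\<Pi>\<^sub>M i\<in>(UNIV :: 'd::finite set). std_normal_distribution) \<rightarrow>\<^sub>M borel"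
proof (rule borel_measurable_euclidean_space[THEN iffD2], intro ballI)
  fix b :: "real ^ 'd" assume "b \<in> Basis"
  then obtain i where "b = axis i 1" by (auto simp: Basis_vec_def)
  then show "(\<lambda>z. (\<chi> i. z i) \<bullet> b) \<in> borel_measurable (\<Pi>\<^sub>M i\<in>(UNIV :: 'd set). std_normal_distribution)"
    using measurable_component_singleton[of i UNIV "\<lambda>_::'d. std_normal_distribution"]
    by (simp add: inner_axis)
qed

text \<open>Coins are indexed by natural numbers, vectors by the elements of a finite type;
  \<open>to_nat_on\<close> translates between the two.\<close>

definition coin_vec :: "(nat \<Rightarrow> real) \<Rightarrow> real ^ 'd::finite" where
  "coin_vec w = (\<chi> i. w (to_nat_on (UNIV :: 'd set) i))"

lemma coin_vec_measurable [measurable]: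
  "(coin_vec :: _ \<Rightarrow> real ^ 'd::finite) \<in> coin_space CARD('d) \<rightarrow>\<^sub>M borel"
proof (rule borel_measurable_euclidean_space[THEN iffD2], intro ballI)
  fix b :: "real ^ 'd" assume "b \<in> Basis"
  then obtain i where b: "b = axis i 1" by (auto simp: Basis_vec_def)
  have "to_nat_on (UNIV :: 'd set) i \<in> {..<CARD('d)}"
    using to_nat_on_finite[of "UNIV :: 'd set"] by (auto simp: bij_betw_def)
  then show "(\<lambda>w. (coin_vec w :: real ^ 'd) \<bullet> b) \<in> borel_measurable (coin_space CARD('d))"
    unfolding b by (simp add: inner_axis coin_vec_def)
qed

text \<open>All factors of the coin law are equal, so relabelling them along the bijection
  \<open>to_nat_on\<close> preserves the product.\<close>

lemma distr_coin_vec: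
  "distr (\<Pi>\<^sub>M i\<in>{..<CARD('d)}. std_normal_distribution) borel coin_vec =
    (std_gaussian :: (real ^ 'd::finite) measure)"
proof -
  let ?t = "to_nat_on (UNIV :: 'd set)" and ?W = "\<Pi>\<^sub>M i\<in>{..<CARD('d)}. std_normal_distribution"
  have bij: "bij_betw ?t UNIV {..<CARD('d)}"
    using to_nat_on_finite[of "UNIV :: 'd set"] by simp
  have re: "(\<lambda>w. \<lambda>i\<in>UNIV. w (?t i)) \<in> ?W \<rightarrow>\<^sub>M (\<Pi>\<^sub>M i\<in>(UNIV :: 'd set). std_normal_distribution)"
    using bij by (intro measurable_restrict measurable_component_singleton) (auto simp: bij_betw_def)
  have "std_gaussian = distr (distr ?W (\<Pi>\<^sub>M i\<in>(UNIV :: 'd set). std_normal_distribution)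
      (\<lambda>w. \<lambda>i\<in>UNIV. w (?t i))) borel (\<lambda>z. \<chi> i. z i)"
    unfolding std_gaussian_def
    using bij real_dist_normal_dist
    by (subst distr_PiM_reindex) (auto simp: bij_betw_def real_distribution_def)
  also have "\<dots> = distr ?W borel coin_vec"
    by (subst distr_distr[OF vec_lambda_measurable_std_normal re]) (simp add: comp_def coin_vec_def[abs_def] restrict_def)
  finally show ?thesis ..
qed

text \<open>An event about one bit is a sum of at most two point masses, each a measurable function
  of \<open>g x\<close>; measurability of these evaluations makes the map a kernel.\<close>

lemma measurable_bernoulli:
  assumes g [measurable]: "g \<in> borel_measurable M" and g01: "\<And>x. g x \<in> {0..1::real}"
  shows "(\<lambda>x. measure_pmf (bernoulli_pmf (g x))) \<in> M \<rightarrow>\<^sub>M prob_algebra (count_space UNIV)"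
proof (rule measurable_prob_algebra_generated[where \<Omega>=UNIV and G=UNIV])
  show "sets (count_space UNIV :: bool measure) = sigma_sets UNIV UNIV"
    by (auto intro: sigma_sets.Basic)
  fix A :: "bool set"
  have "emeasure (measure_pmf (bernoulli_pmf (g x))) A =
      (\<Sum>b\<in>A. ennreal (pmf (bernoulli_pmf (g x)) b))" for x
    by (simp add: emeasure_measure_pmf_finite)
  moreover have "(\<lambda>x. ennreal (pmf (bernoulli_pmf (g x)) b)) \<in> borel_measurable M" for b
    using g01 by (cases b) auto
  ultimately show "(\<lambda>x. emeasure (measure_pmf (bernoulli_pmf (g x))) A) \<in> borel_measurable M"
    by simp
qed (auto simp: Int_stable_def prob_space_measure_pmf)

text \<open>All machines share the kernel, which makes the bits i.i.d. given the coin. The coin is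
  always a standard Gaussian vector; a test without public randomness is one whose \<open>f\<close>
  ignores its second argument.\<close>

definition bit_test ::
    "(real ^ 'd \<Rightarrow> real ^ 'd \<Rightarrow> real) \<Rightarrow> ((nat \<Rightarrow> bool) \<Rightarrow> bool) \<Rightarrow> 'd::finite dist_test" where
  "bit_test f dec =
     \<lparr>coin_dim = CARD('d),
      coin_law = \<Pi>\<^sub>M i\<in>{..<CARD('d)}. std_normal_distribution,
      local_kernel = (\<lambda>j (x, w). measure_pmf (bernoulli_pmf (f x (coin_vec w)))),
      decision = dec\<rparr>"

context
  fixes f :: "real ^ 'd::finite \<Rightarrow> real ^ 'd \<Rightarrow> real"
  assumes f [measurable]: "(\<lambda>(x, u). f x u) \<in> borel_measurable (borel \<Otimes>\<^sub>M borel)"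
    and f01: "\<And>x u. f x u \<in> {0..1}"
begin

lemma bit_test_in_distributed_tests: "bit_test f dec \<in> distributed_tests m"
proof -
  have "prob_space (\<Pi>\<^sub>M i\<in>{..<CARD('d)}. std_normal_distribution)"
    by (intro prob_space_PiM real_dist_normal_dist[THEN real_distribution.axioms(1)])
  moreover have "sets (\<Pi>\<^sub>M i\<in>{..<CARD('d)}. std_normal_distribution) = sets (coin_space CARD('d))"
    by (intro sets_PiM_cong) auto
  moreover have "(\<lambda>(x, w). measure_pmf (bernoulli_pmf (f x (coin_vec w)))) \<in>
      borel \<Otimes>\<^sub>M coin_space CARD('d) \<rightarrow>\<^sub>M prob_algebra (count_space UNIV)"
    unfolding case_prod_beta using f01 by (intro measurable_bernoulli) measurable
  ultimately show ?thesis
    by (simp add: distributed_tests_def bit_test_def space_prob_algebra)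
qed

lemma bit_mean_in_unit_interval: "(\<integral>z. f (\<mu> + s *\<^sub>R z) u \<partial>std_gaussian) \<in> {0..1}"
proof -
  interpret G: prob_space "std_gaussian :: (real ^ 'd) measure" by (rule prob_space_std_gaussian)
  have [measurable_cong]: "sets (std_gaussian :: (real ^ 'd) measure) = sets borel"
    by (rule sets_std_gaussian)
  have [measurable]: "(\<lambda>x. f x u) \<in> borel_measurable borel" for u
    by measurable
  have "integrable std_gaussian (\<lambda>z. f (\<mu> + s *\<^sub>R z) u)"
    using f01 by (intro G.integrable_const_bound[where B=1]) auto
  then show ?thesis
    using f01 G.prob_space integral_mono[of std_gaussian "\<lambda>_. 0" "\<lambda>z. f (\<mu> + s *\<^sub>R z) u"]
      integral_mono[of std_gaussian "\<lambda>z. f (\<mu> + s *\<^sub>R z) u" "\<lambda>_. 1"]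
    by auto
qed

text \<open>By Fubini the data can be integrated out first with the coin held fixed. This leaves
  i.i.d. bits whose mean is a function of the coin, and the law of the bits is the mixture of these
  products over the coin.\<close>

lemma emeasure_bits_law_bit_test:
  assumes A: "A \<subseteq> (\<Pi>\<^sub>E j\<in>{..<m}. UNIV)"
  shows "emeasure (bits_law m n (bit_test f dec) \<mu>) A =
    (\<integral>\<^sup>+u. emeasure (iid_bits m (\<integral>z. f (\<mu> + sqrt (m / n) *\<^sub>R z) u \<partial>std_gaussian)) A \<partial>std_gaussian)"
proof -
  let ?T = "bit_test f dec" and ?D = "data_law m n \<mu>"
  let ?N = "distr std_gaussian borel (\<lambda>z. \<mu> + sqrt (real m / real n) *\<^sub>R z)"
  let ?C = "\<Pi>\<^sub>M i\<in>{..<CARD('d)}. std_normal_distribution"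
  let ?F = "\<lambda>u. emeasure (iid_bits m (\<integral>z. f (\<mu> + sqrt (m / n) *\<^sub>R z) u \<partial>std_gaussian)) A"
  have T: "?T \<in> distributed_tests m" by (rule bit_test_in_distributed_tests)
  have C_eq: "coin_law ?T = ?C" "coin_dim ?T = CARD('d)" by (simp_all add: bit_test_def)
  have D: "prob_space ?D" "sets ?D = sets (\<Pi>\<^sub>M j\<in>{..<m}. borel)"
    using data_law_prob_algebra[of m n \<mu>] by (auto simp: space_prob_algebra)
  have C: "prob_space ?C" "sets ?C = sets (coin_space CARD('d))"
    using T by (auto simp: space_prob_algebra distributed_tests_def C_eq)
  have aff [measurable]: "(\<lambda>z. \<mu> + sqrt (real m / real n) *\<^sub>R z) \<in> std_gaussian \<rightarrow>\<^sub>M borel"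
    by (simp add: measurable_cong_sets[OF sets_std_gaussian refl])
  have N: "prob_space ?N"
    by (rule prob_space.prob_space_distr[OF prob_space_std_gaussian aff])
  interpret D: prob_space ?D by fact
  interpret C: prob_space ?C by fact
  interpret DC: pair_prob_space ?D ?C ..
  \<comment> \<open>The parameter \<open>0\<close> is a placeholder, since the sigma-algebra of the
    Bernoulli product does not depend on it.\<close>
  have A_bits: "A \<in> sets (bits_space m)"
    using A sets_bernoulli_product[of m "\<lambda>_. 0"]
      sets_PiM_cong[of "{..<m}" "{..<m}" "\<lambda>_. measure_pmf (bernoulli_pmf 0)" "\<lambda>_. count_space UNIV"]
    by auto
  have K: "local_bits m ?T \<in> ?D \<Otimes>\<^sub>M ?C \<rightarrow>\<^sub>M subprob_algebra (bits_space m)"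
    using local_bits_measurable[OF T] measurable_prob_algebraD
    by (simp add: C_eq measurable_cong_sets[OF sets_pair_measure_cong[OF D(2) C(2)] refl])
  have m: "(\<lambda>y. emeasure (local_bits m ?T y) A) \<in> borel_measurable (?D \<Otimes>\<^sub>M ?C)"
    using K A_bits by (rule measurable_emeasure_kernel)
  have q_meas [measurable]: "(\<lambda>x. f x u) \<in> borel_measurable borel" for u
    by measurable
  have cv: "coin_vec \<in> ?C \<rightarrow>\<^sub>M (borel :: (real ^ 'd) measure)"
    by (simp add: measurable_cong_sets[OF C(2) refl] coin_vec_measurable)
  have q_eq: "(\<integral>x. f x u \<partial>?N) = (\<integral>z. f (\<mu> + sqrt (m / n) *\<^sub>R z) u \<partial>std_gaussian)" for u
    by (subst integral_distr) auto
  have "emeasure (bits_law m n ?T \<mu>) A = (\<integral>\<^sup>+y. emeasure (local_bits m ?T y) A \<partial>(?D \<Otimes>\<^sub>M ?C))"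
    unfolding bits_law_def C_eq
    by (rule emeasure_bind[OF _ K A_bits]) (rule DC.not_empty)
  also have "\<dots> = (\<integral>\<^sup>+w. \<integral>\<^sup>+x. emeasure (local_bits m ?T (x, w)) A \<partial>?D \<partial>?C)"
    using m by (rule DC.nn_integral_snd[symmetric])
  also have "\<dots> = (\<integral>\<^sup>+w. emeasure (iid_bits m (\<integral>z. f (\<mu> + sqrt (m / n) *\<^sub>R z) (coin_vec w) \<partial>std_gaussian)) A \<partial>?C)"
  proof (rule nn_integral_cong)
    fix w
    have "(\<integral>\<^sup>+x. emeasure (local_bits m ?T (x, w)) A \<partial>?D) =
        emeasure (iid_bits m (\<integral>x. f x (coin_vec w) \<partial>?N)) A"
      unfolding local_bits_def prod.case data_law_def bit_test_def dist_test.simps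
      using f01 by (intro iid_bits_mixture N A) auto
    then show "(\<integral>\<^sup>+x. emeasure (local_bits m ?T (x, w)) A \<partial>?D) =
        emeasure (iid_bits m (\<integral>z. f (\<mu> + sqrt (m / n) *\<^sub>R z) (coin_vec w) \<partial>std_gaussian)) A"
      by (simp add: q_eq)
  qed
  also have "\<dots> = (\<integral>\<^sup>+u. ?F u \<partial>distr ?C borel coin_vec)"
  proof (rule nn_integral_distr[OF cv, of ?F, symmetric])
    interpret G: prob_space "std_gaussian :: (real ^ 'd) measure" by (rule prob_space_std_gaussian)
    have [measurable_cong]: "sets (std_gaussian :: (real ^ 'd) measure) = sets borel"
      by (rule sets_std_gaussian)
    \<comment> \<open>To replace the coin by the Gaussian vector, the inner measure must be
      measurable in \<open>u\<close>: the bit mean is, and the string probabilities are finite sums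
      of products of functions of it.\<close>
    have q [measurable]: "(\<lambda>u. \<integral>z. f (\<mu> + sqrt (m / n) *\<^sub>R z) u \<partial>std_gaussian) \<in> borel_measurable borel"
      by (rule G.borel_measurable_lebesgue_integral) measurable
    have [measurable]: "(\<lambda>u. ennreal (pmf (bernoulli_pmf (\<integral>z. f (\<mu> + sqrt (m / n) *\<^sub>R z) u \<partial>std_gaussian)) b))
        \<in> borel_measurable borel" for b
      using bit_mean_in_unit_interval[of \<mu> "sqrt (m / n)"] by (cases b) auto
    show "?F \<in> borel_measurable (distr ?C borel coin_vec)"
      unfolding emeasure_bernoulli_product[OF A] measurable_distr_eq1
      by (intro borel_measurable_sum borel_measurable_prod_ennreal) measurable
  qed
  finally show ?thesis unfolding distr_coin_vec .
qed

lemma prob_decision_bit_test: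
  "ennreal (prob_decision m n (bit_test f dec) \<mu> b) =
    (\<integral>\<^sup>+u. emeasure (iid_bits m (\<integral>z. f (\<mu> + sqrt (m / n) *\<^sub>R z) u \<partial>std_gaussian))
      {t \<in> (\<Pi>\<^sub>E j\<in>{..<m}. UNIV). dec t = b} \<partial>std_gaussian)"
proof -
  let ?L = "bits_law m n (bit_test f dec) \<mu>"
  have L: "prob_space ?L" "sets ?L = sets (bits_space m)"
    using bits_law_prob_algebra[OF bit_test_in_distributed_tests] by (auto simp: space_prob_algebra)
  interpret L: prob_space ?L by fact
  have "space ?L = (\<Pi>\<^sub>E j\<in>{..<m}. UNIV)"
    using sets_eq_imp_space_eq[OF L(2)] by (simp add: space_PiM)
  moreover have "decision (bit_test f dec) = dec"
    by (simp add: bit_test_def)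
  ultimately show ?thesis
    unfolding prob_decision_def
    by (simp add: L.emeasure_eq_measure[symmetric] emeasure_bits_law_bit_test)
qed

section \<open>Risk bounds for the counting test and for the one-bit test\<close>

text \<open>The decision sees the bits but not the coin, so the null mean \<open>p\<^sub>0\<close>
  has to be the same for every coin value. Under the alternative, acceptance together with a mean
  \<open>2 * \<tau> / m\<close> away from \<open>p\<^sub>0\<close> forces the count to miss its own
  mean by \<open>\<tau>\<close>. Hoeffding's bound is paid once under each hypothesis, and the set
  \<open>B\<close> of bad coins costs \<open>\<eta>\<close>. The test is two-sided, as the sign of
  the shift may depend on the coin.\<close>

lemma counting_test_risk:
  assumes m: "m > 0" and \<tau>: "\<tau> \<ge> 0" and \<eta>: "\<eta> \<ge> 0"
    and null: "\<And>u. (\<integral>z. f (sqrt (m / n) *\<^sub>R z) u \<partial>std_gaussian) = p\<^sub>0"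
    and alt: "\<And>\<mu>. norm \<mu> \<ge> \<rho> \<Longrightarrow> \<exists>B. emeasure std_gaussian B \<le> ennreal \<eta> \<and> B \<in> sets borel \<and>
       (\<forall>u. u \<notin> B \<longrightarrow> \<bar>(\<integral>z. f (\<mu> + sqrt (m / n) *\<^sub>R z) u \<partial>std_gaussian) - p\<^sub>0\<bar> \<ge> 2 * \<tau> / m)"
  shows "test_risk m n \<rho> (bit_test f (\<lambda>t. \<bar>bit_count m t - m * p\<^sub>0\<bar> \<ge> \<tau>))
    \<le> 4 * exp (- 2 * \<tau>\<^sup>2 / m) + \<eta>"
proof -
  let ?c = "2 * exp (- 2 * \<tau>\<^sup>2 / m)"
  let ?q = "\<lambda>\<mu> u. \<integral>z. f (\<mu> + sqrt (m / n) *\<^sub>R z) u \<partial>std_gaussian"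
  interpret G: prob_space "std_gaussian :: (real ^ 'd) measure" by (rule prob_space_std_gaussian)
  have "test_risk m n \<rho> (bit_test f (\<lambda>t. \<bar>bit_count m t - m * p\<^sub>0\<bar> \<ge> \<tau>)) \<le> ?c + (?c + \<eta>)"
  proof (rule test_risk_le)
    have "emeasure (iid_bits m (?q 0 u))
        {t \<in> \<Pi>\<^sub>E j\<in>{..<m}. UNIV. (\<tau> \<le> \<bar>bit_count m t - m * p\<^sub>0\<bar>) = True} \<le> ennreal ?c" for u
    proof (rule emeasure_iid_bits_mono_le[OF _ _ bit_count_concentration[OF _ m \<tau>]])
      show "?q 0 u \<in> {0..1}" by (rule bit_mean_in_unit_interval)
    next
      show "{t \<in> \<Pi>\<^sub>E j\<in>{..<m}. UNIV. (\<tau> \<le> \<bar>bit_count m t - m * p\<^sub>0\<bar>) = True}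
          \<subseteq> {t \<in> \<Pi>\<^sub>E j\<in>{..<m}. UNIV. \<tau> \<le> \<bar>bit_count m t - m * ?q 0 u\<bar>}"
        by (simp add: null)
    qed blast
    then have "(\<integral>\<^sup>+u. emeasure (iid_bits m (?q 0 u))
        {t \<in> \<Pi>\<^sub>E j\<in>{..<m}. UNIV. (\<tau> \<le> \<bar>bit_count m t - m * p\<^sub>0\<bar>) = True} \<partial>std_gaussian)
        \<le> (\<integral>\<^sup>+u. ennreal ?c \<partial>(std_gaussian :: (real ^ 'd) measure))"
      by (intro nn_integral_mono)
    then show "ennreal (prob_decision m n (bit_test f (\<lambda>t. \<tau> \<le> \<bar>bit_count m t - m * p\<^sub>0\<bar>)) 0 True)
        \<le> ennreal ?c"
      by (simp add: prob_decision_bit_test G.emeasure_space_1)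
  next
    fix \<mu> :: "real ^ 'd" assume "norm \<mu> \<ge> \<rho>"
    then obtain B where B: "emeasure std_gaussian B \<le> ennreal \<eta>" "B \<in> sets borel"
      and far: "\<And>u. u \<notin> B \<Longrightarrow> \<bar>?q \<mu> u - p\<^sub>0\<bar> \<ge> 2 * \<tau> / m"
      using alt by blast
    \<comment> \<open>Bad coins are charged the trivial bound 1 through the indicator, so that the
      estimate can be integrated over all coins at once.\<close>
    have "emeasure (iid_bits m (?q \<mu> u))
        {t \<in> \<Pi>\<^sub>E j\<in>{..<m}. UNIV. (\<tau> \<le> \<bar>bit_count m t - m * p\<^sub>0\<bar>) = False} \<le> ennreal ?c + indicator B u" for u
    proof (cases "u \<in> B")
      case True
      interpret prob_space "iid_bits m (?q \<mu> u)" by (rule prob_space_iid_bits)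
      show ?thesis
        using True emeasure_le_1 by (simp add: add_increasing)
    next
      case False
      have "m * \<bar>?q \<mu> u - p\<^sub>0\<bar> \<ge> 2 * \<tau>"
        using far[OF False] m by (simp add: field_simps)
      then have sep: "\<bar>m * ?q \<mu> u - m * p\<^sub>0\<bar> \<ge> 2 * \<tau>"
      unfolding right_diff_distrib[symmetric] by (simp add: abs_mult)
      have "emeasure (iid_bits m (?q \<mu> u))
          {t \<in> \<Pi>\<^sub>E j\<in>{..<m}. UNIV. (\<tau> \<le> \<bar>bit_count m t - m * p\<^sub>0\<bar>) = False} \<le> ennreal ?c"
      proof (rule emeasure_iid_bits_mono_le[OF _ _ bit_count_concentration[OF bit_mean_in_unit_interval m \<tau>]])
        have "\<bar>x - m * ?q \<mu> u\<bar> \<ge> \<tau>" if "\<not> \<tau> \<le> \<bar>x - m * p\<^sub>0\<bar>" for x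
          using sep that by linarith
        then show "{t \<in> \<Pi>\<^sub>E j\<in>{..<m}. UNIV. (\<tau> \<le> \<bar>bit_count m t - m * p\<^sub>0\<bar>) = False}
            \<subseteq> {t \<in> \<Pi>\<^sub>E j\<in>{..<m}. UNIV. \<tau> \<le> \<bar>bit_count m t - m * ?q \<mu> u\<bar>}"
          by blast
      qed blast
      then show ?thesis using False by simp
    qed
    then have "(\<integral>\<^sup>+u. emeasure (iid_bits m (?q \<mu> u))
        {t \<in> \<Pi>\<^sub>E j\<in>{..<m}. UNIV. (\<tau> \<le> \<bar>bit_count m t - m * p\<^sub>0\<bar>) = False} \<partial>std_gaussian)
        \<le> (\<integral>\<^sup>+u. ennreal ?c + indicator B u \<partial>std_gaussian)"
      by (intro nn_integral_mono)
    also have "\<dots> = ennreal ?c + emeasure std_gaussian B"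
      using B(2) by (subst nn_integral_add) (auto simp: G.emeasure_space_1 sets_std_gaussian intro!: borel_measurable_indicator)
    also have "\<dots> \<le> ennreal (?c + \<eta>)"
      using B(1) \<eta> by (simp add: ennreal_plus)
    finally show "ennreal (prob_decision m n (bit_test f (\<lambda>t. \<tau> \<le> \<bar>bit_count m t - m * p\<^sub>0\<bar>)) \<mu> False)
        \<le> ennreal (?c + \<eta>)"
      by (simp add: prob_decision_bit_test)
  qed (use \<eta> in auto)
  then show ?thesis by simp
qed

text \<open>The decision copies the bit of machine \<open>0\<close>, which exists because
  \<open>m > 0\<close>; its mean is then the rejection probability given the coin.\<close>

lemma single_machine_test_risk:
  assumes m: "m > 0" and "0 \<le> \<epsilon>\<^sub>1" "0 \<le> \<epsilon>\<^sub>2"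
    and null: "\<And>u. (\<integral>z. f (sqrt (m / n) *\<^sub>R z) u \<partial>std_gaussian) \<le> \<epsilon>\<^sub>1"
    and alt: "\<And>\<mu> u. norm \<mu> \<ge> \<rho> \<Longrightarrow> (\<integral>z. f (\<mu> + sqrt (m / n) *\<^sub>R z) u \<partial>std_gaussian) \<ge> 1 - \<epsilon>\<^sub>2"
  shows "test_risk m n \<rho> (bit_test f (\<lambda>t. t 0)) \<le> \<epsilon>\<^sub>1 + \<epsilon>\<^sub>2"
proof -
  let ?q = "\<lambda>\<mu> u. \<integral>z. f (\<mu> + sqrt (m / n) *\<^sub>R z) u \<partial>std_gaussian"
  interpret G: prob_space "std_gaussian :: (real ^ 'd) measure" by (rule prob_space_std_gaussian)
  \<comment> \<open>The marginal of the product at coordinate \<open>0\<close> is a single Bernoulli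
    law.\<close>
  have bit: "emeasure (iid_bits m p) {t \<in> \<Pi>\<^sub>E j\<in>{..<m}. UNIV. t 0 = b} = ennreal (pmf (bernoulli_pmf p) b)"
    for p b
  proof -
    have "emeasure (distr (iid_bits m p) (measure_pmf (bernoulli_pmf p)) (\<lambda>t. t 0)) {b} =
        emeasure (iid_bits m p) {t \<in> \<Pi>\<^sub>E j\<in>{..<m}. UNIV. t 0 = b}"
      using m measurable_component_singleton[of 0 "{..<m}" "\<lambda>_. measure_pmf (bernoulli_pmf p)"]
      by (subst emeasure_distr) (auto simp: space_PiM intro!: arg_cong2[where f=emeasure])
    moreover have "distr (iid_bits m p) (measure_pmf (bernoulli_pmf p)) (\<lambda>t. t 0) = measure_pmf (bernoulli_pmf p)"
      using m by (intro distr_PiM_component) (auto simp: prob_space_measure_pmf)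
    ultimately show ?thesis by (simp add: emeasure_pmf_single)
  qed
  have pmf: "pmf (bernoulli_pmf (?q \<mu> u)) True = ?q \<mu> u" "pmf (bernoulli_pmf (?q \<mu> u)) False = 1 - ?q \<mu> u"
    for \<mu> u
    using bit_mean_in_unit_interval[of \<mu> "sqrt (m / n)" u] by auto
  show ?thesis
  proof (rule test_risk_le)
    have "(\<integral>\<^sup>+u. ennreal (pmf (bernoulli_pmf (?q 0 u)) True) \<partial>std_gaussian)
        \<le> (\<integral>\<^sup>+u. ennreal \<epsilon>\<^sub>1 \<partial>(std_gaussian :: (real ^ 'd) measure))"
      unfolding pmf using null by (intro nn_integral_mono ennreal_leI) simp
    then show "ennreal (prob_decision m n (bit_test f (\<lambda>t. t 0)) 0 True) \<le> ennreal \<epsilon>\<^sub>1"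
      unfolding prob_decision_bit_test bit by (simp add: G.emeasure_space_1)
  next
    fix \<mu> :: "real ^ 'd" assume "norm \<mu> \<ge> \<rho>"
    then have "1 - ?q \<mu> u \<le> \<epsilon>\<^sub>2" for u
      using alt[of \<mu> u] by simp
    then have "(\<integral>\<^sup>+u. ennreal (pmf (bernoulli_pmf (?q \<mu> u)) False) \<partial>std_gaussian)
        \<le> (\<integral>\<^sup>+u. ennreal \<epsilon>\<^sub>2 \<partial>(std_gaussian :: (real ^ 'd) measure))"
      unfolding pmf by (intro nn_integral_mono ennreal_leI)
    then show "ennreal (prob_decision m n (bit_test f (\<lambda>t. t 0)) \<mu> False) \<le> ennreal \<epsilon>\<^sub>2"
      unfolding prob_decision_bit_test bit by (simp add: G.emeasure_space_1)
  qed (use assms in auto)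
qed

end

section \<open>Gaussian vectors\<close>

lemma borel_measurable_std_gaussian [simp]:
  "(std_gaussian :: (real ^ 'd::finite) measure) \<rightarrow>\<^sub>M M = borel \<rightarrow>\<^sub>M M"
  by (rule measurable_cong_sets[OF sets_std_gaussian refl])

lemma prob_space_std_normal: "prob_space std_normal_distribution"
  by (rule real_dist_normal_dist[THEN real_distribution.axioms(1)])

lemma distr_std_gaussian_component:
  "distr std_gaussian borel (\<lambda>z :: real ^ 'd::finite. z $ i) = std_normal_distribution"
proof -
  let ?P = "\<Pi>\<^sub>M i\<in>(UNIV :: 'd set). std_normal_distribution"
  have "distr std_gaussian borel (\<lambda>z :: real ^ 'd. z $ i) = distr ?P borel (\<lambda>z. z i)"
    unfolding std_gaussian_def
    by (subst distr_distr[OF _ vec_lambda_measurable_std_normal]) (auto simp: comp_def)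
  also have "\<dots> = distr ?P std_normal_distribution (\<lambda>z. z i)"
    by (intro distr_cong) auto
  also have "\<dots> = std_normal_distribution"
    by (intro distr_PiM_component prob_space_std_normal) auto
  finally show ?thesis .
qed

text \<open>Reading off the coordinates undoes the map that assembles the vector, so their joint law
  is the product measure that \<open>std_gaussian\<close> was built from.\<close>

lemma indep_vars_std_gaussian:
  "prob_space.indep_vars std_gaussian (\<lambda>_. borel) (\<lambda>i (z :: real ^ 'd::finite). z $ i) UNIV"
proof -
  let ?P = "\<Pi>\<^sub>M i\<in>(UNIV :: 'd set). std_normal_distribution"
  interpret G: prob_space "std_gaussian :: (real ^ 'd) measure" by (rule prob_space_std_gaussian)
  have sets: "sets ?P = sets (\<Pi>\<^sub>M i\<in>UNIV. borel)"
    by (intro sets_PiM_cong) auto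
  show ?thesis
  proof (subst G.indep_vars_iff_distr_eq_PiM')
    have "distr std_gaussian (\<Pi>\<^sub>M i\<in>UNIV. borel) (\<lambda>z :: real ^ 'd. \<lambda>i\<in>UNIV. z $ i) =
        distr ?P (\<Pi>\<^sub>M i\<in>UNIV. borel) (\<lambda>z. \<lambda>i\<in>UNIV. (\<chi> i. z i) $ i)"
      unfolding std_gaussian_def
      by (subst distr_distr[OF _ vec_lambda_measurable_std_normal]) (auto simp: comp_def)
    also have "\<dots> = distr ?P (\<Pi>\<^sub>M i\<in>UNIV. borel) (\<lambda>z. z)"
      by (intro distr_cong) (auto simp: restrict_def)
    also have "\<dots> = ?P" by (rule distr_id2) (simp add: sets)
    finally show "distr std_gaussian (\<Pi>\<^sub>M i\<in>UNIV. borel) (\<lambda>z :: real ^ 'd. \<lambda>i\<in>UNIV. z $ i) =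
        (\<Pi>\<^sub>M i\<in>UNIV. distr std_gaussian borel (\<lambda>z :: real ^ 'd. z $ i))"
      by (simp add: distr_std_gaussian_component)
  qed auto
qed

lemma distributed_inner_std_gaussian:
  fixes a :: "real ^ 'd::finite"
  assumes "a \<noteq> 0"
  shows "distributed std_gaussian lborel (\<lambda>z. a \<bullet> z) (normal_density 0 (norm a))"
proof -
  interpret G: prob_space "std_gaussian :: (real ^ 'd) measure" by (rule prob_space_std_gaussian)
  \<comment> \<open>A vanishing coefficient gives a degenerate variable without density, so the
    theorem on sums of independent normals is applied to the nonzero coordinates only.\<close>
  let ?I = "{i. a $ i \<noteq> 0}"
  have comp: "distributed std_gaussian lborel (\<lambda>z :: real ^ 'd. z $ i) std_normal_density" for i
  proof -
    have "distr std_gaussian lborel (\<lambda>z :: real ^ 'd. z $ i) = std_normal_distribution"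
      unfolding distr_std_gaussian_component[of i, symmetric] by (intro distr_cong) auto
    then show ?thesis by (simp add: distributed_def)
  qed
  have ne: "?I \<noteq> {}" using assms by (auto simp: vec_eq_iff)
  have indep: "G.indep_vars (\<lambda>_. borel) (\<lambda>i z. a $ i * z $ i) ?I"
    by (rule G.indep_vars_subset[OF G.indep_vars_compose2[OF indep_vars_std_gaussian]]) auto
  have "distributed std_gaussian lborel (\<lambda>z. a $ i * z $ i) (normal_density 0 \<bar>a $ i\<bar>)" if "i \<in> ?I" for i
    using G.normal_density_affine[OF comp[of i], of "a $ i" 0] that by simp
  then have "distributed std_gaussian lborel (\<lambda>z. \<Sum>i\<in>?I. a $ i * z $ i)
      (normal_density (\<Sum>i\<in>?I. 0) (sqrt (\<Sum>i\<in>?I. \<bar>a $ i\<bar>\<^sup>2)))"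
    using ne indep by (intro G.sum_indep_normal) auto
  moreover have "(\<lambda>z. \<Sum>i\<in>?I. a $ i * z $ i) = (\<lambda>z. a \<bullet> z)"
    unfolding inner_vec_def inner_real_def by (intro ext sum.mono_neutral_left) auto
  moreover have "(\<Sum>i\<in>?I. \<bar>a $ i\<bar>\<^sup>2) = (\<Sum>i\<in>UNIV. (a $ i)\<^sup>2)"
    by (simp, intro sum.mono_neutral_left) auto
  moreover have "norm a = sqrt (\<Sum>i\<in>UNIV. (a $ i)\<^sup>2)"
    by (simp add: norm_vec_def L2_set_def)
  ultimately show ?thesis by simp
qed

lemma distr_normalized_inner_std_gaussian:
  fixes a :: "real ^ 'd::finite"
  assumes "a \<noteq> 0"
  shows "distr std_gaussian borel (\<lambda>z. a \<bullet> z / norm a) = std_normal_distribution"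
proof -
  interpret G: prob_space "std_gaussian :: (real ^ 'd) measure" by (rule prob_space_std_gaussian)
  have "distributed std_gaussian lborel (\<lambda>z. (a \<bullet> z - 0) / norm a) std_normal_density"
    using distributed_inner_std_gaussian[OF assms] assms
    by (subst G.normal_standard_normal_convert[symmetric]) auto
  then have "distr std_gaussian lborel (\<lambda>z. a \<bullet> z / norm a) = std_normal_distribution"
    by (simp add: distributed_def)
  moreover have "distr std_gaussian lborel (\<lambda>z. a \<bullet> z / norm a) = distr std_gaussian borel (\<lambda>z. a \<bullet> z / norm a)"
    by (intro distr_cong) auto
  ultimately show ?thesis by simp
qed

section \<open>Estimates for the standard normal law near the origin\<close>

text \<open>On \<open>{-1..1}\<close> the density is at least \<open>1 / 3 * (1 / 2)\<close>,
  because \<open>sqrt (2 * pi) \<le> 3\<close> and \<open>exp (- y) \<ge> 1 - y\<close>. Half-open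
  intervals are used so that they can be glued disjointly to half lines.\<close>

lemma measure_std_normal_interval_ge:
  assumes "a \<le> b" "-1 \<le> a" "b \<le> 1"
  shows "measure std_normal_distribution {a..<b} \<ge> (b - a) / 6"
proof -
  interpret prob_space std_normal_distribution by (rule prob_space_std_normal)
  have dens: "std_normal_density x \<ge> 1 / 6" if "x \<in> {a..<b}" for x
  proof -
    have "\<bar>x\<bar> \<le> 1" using that assms by auto
    then have "x\<^sup>2 \<le> 1" by (simp add: abs_square_le_1)
    have "sqrt (2 * pi) \<le> sqrt (3\<^sup>2)"
      using pi_approx by (intro real_sqrt_le_mono) simp
    then have "sqrt (2 * pi) \<le> 3" by simp
    moreover have "exp (- x\<^sup>2 / 2) \<ge> 1 / 2"
      using exp_ge_add_one_self[of "- x\<^sup>2 / 2"] \<open>x\<^sup>2 \<le> 1\<close> by simp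
    ultimately have "1 / 3 * (1 / 2) \<le> 1 / sqrt (2 * pi) * exp (- x\<^sup>2 / 2)"
      by (intro mult_mono) (auto simp: field_simps)
    then show ?thesis by (simp add: std_normal_density_def)
  qed
  have "ennreal ((b - a) / 6) = (\<integral>\<^sup>+x. ennreal (1 / 6) * indicator {a..<b} x \<partial>lborel)"
    using assms by (subst nn_integral_cmult_indicator) (auto simp: ennreal_mult[symmetric])
  also have "\<dots> \<le> (\<integral>\<^sup>+x. ennreal (std_normal_density x) * indicator {a..<b} x \<partial>lborel)"
    using dens by (intro nn_integral_mono) (auto simp: indicator_def intro!: ennreal_leI)
  also have "\<dots> = emeasure std_normal_distribution {a..<b}"
    by (subst emeasure_density) auto
  finally show ?thesis
    by (simp add: emeasure_eq_measure)
qed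

text \<open>The density is at most \<open>1 / 2\<close>, since \<open>2 * pi \<ge> 4\<close>, and
  the interval has length \<open>2 * t\<close>. This is the anticoncentration that keeps the
  projection of the signal on a random direction away from zero.\<close>

lemma measure_std_normal_symmetric_le:
  assumes "t \<ge> 0"
  shows "measure std_normal_distribution {-t..t} \<le> t"
proof -
  interpret prob_space std_normal_distribution by (rule prob_space_std_normal)
  have dens: "std_normal_density x \<le> 1 / 2" for x
  proof -
    have "sqrt (2\<^sup>2) \<le> sqrt (2 * pi)"
      using pi_approx by (intro real_sqrt_le_mono) simp
    then have "1 / sqrt (2 * pi) * exp (- x\<^sup>2 / 2) \<le> 1 / 2 * 1"
      by (intro mult_mono) (auto simp: field_simps)
    then show ?thesis by (simp add: std_normal_density_def)
  qed
  have "emeasure std_normal_distribution {-t..t} =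
      (\<integral>\<^sup>+x. ennreal (std_normal_density x) * indicator {-t..t} x \<partial>lborel)"
    by (subst emeasure_density) auto
  also have "\<dots> \<le> (\<integral>\<^sup>+x. ennreal (1 / 2) * indicator {-t..t} x \<partial>lborel)"
    by (intro nn_integral_mono mult_right_mono ennreal_leI dens) auto
  also have "\<dots> = ennreal (1 / 2) * ennreal (2 * t)"
    using assms by (subst nn_integral_cmult_indicator) auto
  also have "\<dots> = ennreal t"
    using assms by (subst ennreal_mult[symmetric]) auto
  finally show ?thesis
    using assms by (simp add: emeasure_eq_measure)
qed

lemma measure_std_normal_nonneg: "measure std_normal_distribution {0..} = 1 / 2"
proof -
  interpret prob_space std_normal_distribution by (rule prob_space_std_normal)
  have "emeasure std_normal_distribution {0..} =
      (\<integral>\<^sup>+x. ennreal (std_normal_density x) * indicator {0..} x \<partial>lborel)"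
    by (subst emeasure_density) auto
  \<comment> \<open>Reflection at the origin leaves the density unchanged.\<close>
  also have "\<dots> = (\<integral>\<^sup>+x. ennreal (std_normal_density x) * indicator {..0} x \<partial>lborel)"
    by (subst nn_integral_real_affine[where c="-1" and t=0])
       (auto simp: std_normal_density_def indicator_def intro!: nn_integral_cong)
  also have "\<dots> = emeasure std_normal_distribution {..0}"
    by (subst emeasure_density) auto
  finally have eq: "prob {0..} = prob {..0}"
    by (simp add: emeasure_eq_measure)
  have "prob {0} \<le> 0"
    using measure_std_normal_symmetric_le[of 0] by simp
  then have "prob ({0..} - {0}) = prob {0..}"
    by (subst finite_measure_Diff) (auto intro: antisym)
  moreover have "{0::real..} - {0} = UNIV - {..0}" by auto
  moreover have "prob (UNIV - {..0}) = 1 - prob {..0}"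
    using prob_compl[of "{..0}"] by simp
  ultimately show ?thesis using eq by simp
qed

text \<open>The half lines \<open>{-t..}\<close> and \<open>{0..}\<close> differ by an interval
  between \<open>0\<close> and \<open>-t\<close>. Only its part within distance 1 of the origin is
  counted, whence the minimum; the sign of \<open>t\<close> decides whether mass is gained or
  lost.\<close>

lemma measure_std_normal_tail_gap:
  "\<bar>measure std_normal_distribution {-t..} - 1 / 2\<bar> \<ge> min \<bar>t\<bar> 1 / 6"
proof -
  interpret prob_space std_normal_distribution by (rule prob_space_std_normal)
  let ?s = "min \<bar>t\<bar> 1"
  show ?thesis
  proof (cases "t \<ge> 0")
    case True
    have "?s / 6 \<le> prob {-?s..<0}"
      using measure_std_normal_interval_ge[of "-?s" 0] by simp
    also have "prob {-?s..<0} + prob {0..} = prob ({-?s..<0} \<union> {0..})"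
      by (intro finite_measure_Union[symmetric]) auto
    then have "prob {-?s..<0} = prob ({-?s..<0} \<union> {0..}) - 1 / 2"
      by (simp add: measure_std_normal_nonneg)
    also have "prob ({-?s..<0} \<union> {0..}) \<le> prob {-t..}"
      using True by (intro finite_measure_mono) auto
    finally show ?thesis by simp
  next
    case False
    have "?s / 6 \<le> prob {0..<?s}"
      using measure_std_normal_interval_ge[of 0 ?s] by simp
    also have "\<dots> \<le> prob {0..<-t}"
      using False by (intro finite_measure_mono) auto
    also have "prob {0..<-t} + prob {-t..} = prob ({0..<-t} \<union> {-t..})"
      by (intro finite_measure_Union[symmetric]) auto
    then have "prob {0..<-t} + prob {-t..} = prob {0..}"
      using False by (simp add: ivl_disj_un)
    then have "prob {0..<-t} = 1 / 2 - prob {-t..}"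
      by (simp add: measure_std_normal_nonneg)
    finally show ?thesis by simp
  qed
qed

section \<open>First and second moments of coordinatewise statistics\<close>

text \<open>The coordinates are independent and \<open>h\<close> is centred, so the off-diagonal
  terms of the expanded square vanish. The instances used are \<open>h x = x\<close>, for inner
  products, and \<open>h x = x^2 - 1\<close> with all coefficients 1, for the squared norm.\<close>

lemma std_gaussian_linear_statistic:
  fixes h :: "real \<Rightarrow> real" and a :: "real ^ 'd::finite"
  assumes h [measurable]: "h \<in> borel_measurable borel"
    and int: "integrable std_normal_distribution h" "integrable std_normal_distribution (\<lambda>x. (h x)\<^sup>2)"
    and mean: "(\<integral>x. h x \<partial>std_normal_distribution) = 0"
  shows "integrable std_gaussian (\<lambda>z :: real ^ 'd. \<Sum>i\<in>UNIV. a $ i * h (z $ i))"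
    and "(\<integral>z. (\<Sum>i\<in>UNIV. a $ i * h (z $ i)) \<partial>(std_gaussian :: (real ^ 'd) measure)) = 0"
    and "integrable std_gaussian (\<lambda>z :: real ^ 'd. (\<Sum>i\<in>UNIV. a $ i * h (z $ i))\<^sup>2)"
    and "(\<integral>z. (\<Sum>i\<in>UNIV. a $ i * h (z $ i))\<^sup>2 \<partial>(std_gaussian :: (real ^ 'd) measure)) =
      (\<integral>x. (h x)\<^sup>2 \<partial>std_normal_distribution) * (norm a)\<^sup>2"
proof -
  interpret G: prob_space "std_gaussian :: (real ^ 'd) measure" by (rule prob_space_std_gaussian)
  define v where "v = (\<integral>x. (h x)\<^sup>2 \<partial>std_normal_distribution)"
  have comp_int: "integrable std_gaussian (\<lambda>z :: real ^ 'd. g (z $ i)) \<longleftrightarrow> integrable std_normal_distribution g"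
    and comp_eq: "(\<integral>z. g (z $ i) \<partial>(std_gaussian :: (real ^ 'd) measure)) = (\<integral>x. g x \<partial>std_normal_distribution)"
    if [measurable]: "g \<in> borel_measurable borel" for g :: "real \<Rightarrow> real" and i
    using integrable_distr_eq[of "\<lambda>z. z $ i" std_gaussian borel g] integral_distr[of "\<lambda>z. z $ i" std_gaussian borel g] that
    by (simp_all add: distr_std_gaussian_component)
  have int1: "integrable std_gaussian (\<lambda>z :: real ^ 'd. h (z $ i))" for i
    using int by (simp add: comp_int)
  have indep: "G.indep_vars (\<lambda>_. borel) (\<lambda>i z. h (z $ i)) {i, j}" for i j
    by (rule G.indep_vars_subset[OF G.indep_vars_compose2[OF indep_vars_std_gaussian]]) auto
  have prod: "integrable std_gaussian (\<lambda>z :: real ^ 'd. h (z $ i) * h (z $ j)) \<and>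
      (\<integral>z. h (z $ i) * h (z $ j) \<partial>(std_gaussian :: (real ^ 'd) measure)) = (if i = j then v else 0)" for i j
  proof (cases "i = j")
    case True
    then show ?thesis
      using int comp_int[of "\<lambda>x. (h x)\<^sup>2" i] comp_eq[of "\<lambda>x. (h x)\<^sup>2" i]
      by (simp add: v_def power2_eq_square)
  next
    case False
    then show ?thesis
      using G.indep_vars_integrable[OF _ indep[of i j] int1] G.indep_vars_lebesgue_integral[OF _ indep[of i j] int1]
        comp_eq[OF h] mean
      by simp
  qed
  have sq: "(\<Sum>i\<in>UNIV. a $ i * h (z $ i))\<^sup>2 = (\<Sum>i\<in>UNIV. \<Sum>j\<in>UNIV. (a $ i * a $ j) * (h (z $ i) * h (z $ j)))" for z :: "real ^ 'd"
    by (simp add: power2_eq_square sum_product ac_simps)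
  show "integrable std_gaussian (\<lambda>z :: real ^ 'd. \<Sum>i\<in>UNIV. a $ i * h (z $ i))"
    using int1 by simp
  show "(\<integral>z. (\<Sum>i\<in>UNIV. a $ i * h (z $ i)) \<partial>(std_gaussian :: (real ^ 'd) measure)) = 0"
    using int1 comp_eq[OF h] mean by (simp add: integral_sum)
  show "integrable std_gaussian (\<lambda>z :: real ^ 'd. (\<Sum>i\<in>UNIV. a $ i * h (z $ i))\<^sup>2)"
    unfolding sq using prod by (intro Bochner_Integration.integrable_sum integrable_mult_right) blast
  have "(\<integral>z. (\<Sum>i\<in>UNIV. a $ i * h (z $ i))\<^sup>2 \<partial>(std_gaussian :: (real ^ 'd) measure)) =
      (\<Sum>i\<in>UNIV. \<Sum>j\<in>UNIV. (a $ i * a $ j) * (if i = j then v else 0))"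
    unfolding sq using prod
    by (simp add: integral_sum Bochner_Integration.integrable_sum integrable_mult_right)
  also have "\<dots> = v * (\<Sum>i\<in>UNIV. (a $ i)\<^sup>2)"
    by (simp add: sum_distrib_left power2_eq_square mult.commute if_distrib cong: if_cong)
  also have "(\<Sum>i\<in>UNIV. (a $ i)\<^sup>2) = (norm a)\<^sup>2"
    by (simp add: norm_vec_def L2_set_def sum_nonneg)
  finally show "(\<integral>z. (\<Sum>i\<in>UNIV. a $ i * h (z $ i))\<^sup>2 \<partial>(std_gaussian :: (real ^ 'd) measure)) =
      (\<integral>x. (h x)\<^sup>2 \<partial>std_normal_distribution) * (norm a)\<^sup>2"
    by (simp add: v_def)
qed

lemma std_gaussian_inner_moments:
  fixes a :: "real ^ 'd::finite"
  shows "integrable std_gaussian (\<lambda>z. a \<bullet> z)" "(\<integral>z. a \<bullet> z \<partial>std_gaussian) = 0"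
    "integrable std_gaussian (\<lambda>z. (a \<bullet> z)\<^sup>2)" "(\<integral>z. (a \<bullet> z)\<^sup>2 \<partial>std_gaussian) = (norm a)\<^sup>2"
proof -
  have "integrable std_normal_distribution (\<lambda>x. x)" "(\<integral>x. x \<partial>std_normal_distribution) = 0"
    using integrable_std_normal_distribution_moment[of 1] integral_std_normal_distribution_moment_odd[of 1]
    by simp_all
  moreover have "integrable std_normal_distribution (\<lambda>x. x\<^sup>2)" "(\<integral>x. x\<^sup>2 \<partial>std_normal_distribution) = 1"
    using std_normal_distribution_even_moments[of 1] by (simp_all only: mult_1_right) simp
  moreover have "(\<lambda>z. a \<bullet> z) = (\<lambda>z. \<Sum>i\<in>UNIV. a $ i * z $ i)"
    by (simp only: inner_vec_def inner_real_def)
  ultimately show "integrable std_gaussian (\<lambda>z. a \<bullet> z)" "(\<integral>z. a \<bullet> z \<partial>std_gaussian) = 0"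
    "integrable std_gaussian (\<lambda>z. (a \<bullet> z)\<^sup>2)" "(\<integral>z. (a \<bullet> z)\<^sup>2 \<partial>std_gaussian) = (norm a)\<^sup>2"
    using std_gaussian_linear_statistic[of "\<lambda>x. x" a] by (simp_all only: measurable_ident_sets)
qed

lemma std_gaussian_norm_moments:
  defines "Q \<equiv> \<lambda>z :: real ^ 'd::finite. (norm z)\<^sup>2 - CARD('d)"
  shows "integrable std_gaussian Q" "(\<integral>z. Q z \<partial>std_gaussian) = 0"
    "integrable std_gaussian (\<lambda>z. (Q z)\<^sup>2)" "(\<integral>z. (Q z)\<^sup>2 \<partial>std_gaussian) = 2 * CARD('d)"
proof -
  interpret N: prob_space std_normal_distribution by (rule prob_space_std_normal)
  define h :: "real \<Rightarrow> real" where "h x = x\<^sup>2 - 1" for x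
  have m2: "(\<integral>x. x\<^sup>2 \<partial>std_normal_distribution) = 1" "integrable std_normal_distribution (\<lambda>x. x\<^sup>2)"
    using std_normal_distribution_even_moments[of 1] by (simp_all only: mult_1_right) simp
  \<comment> \<open>The even moment formula \<open>fact (2 * k) / (2 ^ k * fact k)\<close> at
    \<open>k = 2\<close>: the fourth moment is 3, so \<open>h\<close> has second moment
    \<open>3 - 2 + 1 = 2\<close>.\<close>
  have eval4: "(2 * 2 :: nat) = 4" "fact 4 / (2\<^sup>2 * fact 2) = (3 :: real)"
    by (simp_all add: fact_numeral)
  have m4: "(\<integral>x. x ^ 4 \<partial>std_normal_distribution) = 3" "integrable std_normal_distribution (\<lambda>x. x ^ 4)"
    using std_normal_distribution_even_moments[of 2] unfolding eval4 by blast+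
  have h2: "(h x)\<^sup>2 = x ^ 4 - 2 * x\<^sup>2 + 1" for x
    by (simp add: h_def power2_eq_square power4_eq_xxxx algebra_simps)
  have "integrable std_normal_distribution h" "(\<integral>x. h x \<partial>std_normal_distribution) = 0"
    using m2 N.prob_space by (simp_all add: h_def[abs_def])
  moreover have "integrable std_normal_distribution (\<lambda>x. (h x)\<^sup>2)" "(\<integral>x. (h x)\<^sup>2 \<partial>std_normal_distribution) = 2"
    using m2 m4 N.prob_space by (simp_all add: h2)
  moreover have "h \<in> borel_measurable borel" by (simp add: h_def[abs_def])
  moreover have "Q = (\<lambda>z. \<Sum>i\<in>UNIV. (1 :: real ^ 'd) $ i * h (z $ i))"
    by (rule ext) (simp add: Q_def h_def sum_subtractf norm_vec_def L2_set_def sum_nonneg)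
  moreover have "(norm (1 :: real ^ 'd))\<^sup>2 = CARD('d)"
    by (simp add: norm_vec_def L2_set_def)
  ultimately show "integrable std_gaussian Q" "(\<integral>z. Q z \<partial>std_gaussian) = 0"
    "integrable std_gaussian (\<lambda>z. (Q z)\<^sup>2)" "(\<integral>z. (Q z)\<^sup>2 \<partial>std_gaussian) = 2 * CARD('d)"
    using std_gaussian_linear_statistic[of h "1 :: real ^ 'd"] by simp_all
qed

section \<open>The clipped energy statistic\<close>

text \<open>A centred chi-square variable, scaled so that under the standard Gaussian law its mean
  is 0 and its variance 2 in every dimension.\<close>

definition energy :: "real ^ 'd::finite \<Rightarrow> real" where
  "energy y = ((norm y)\<^sup>2 - CARD('d)) / sqrt CARD('d)"

lemma energy_measurable [measurable]: "energy \<in> borel_measurable borel"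
  unfolding energy_def[abs_def] by measurable

lemma energy_shift:
  "energy (\<theta> + z :: real ^ 'd::finite) =
    energy z + ((norm \<theta>)\<^sup>2 / sqrt CARD('d) + 2 * (\<theta> \<bullet> z) / sqrt CARD('d))"
  by (simp add: energy_def power2_norm_eq_inner inner_add_left inner_add_right inner_commute
      flip: add_divide_distrib diff_divide_distrib)

lemma std_gaussian_energy_moments:
  shows "integrable std_gaussian (energy :: real ^ 'd::finite \<Rightarrow> _)"
    "(\<integral>z. energy z \<partial>(std_gaussian :: (real ^ 'd) measure)) = 0"
    "integrable std_gaussian (\<lambda>z :: real ^ 'd. (energy z)\<^sup>2)"
    "(\<integral>z. (energy z)\<^sup>2 \<partial>(std_gaussian :: (real ^ 'd) measure)) = 2"
  using std_gaussian_norm_moments[where 'd='d]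
  by (simp_all add: energy_def[abs_def] power_divide)

text \<open>The deviation from \<delta> is \<open>energy z\<close> plus a linear term in
  \<open>z\<close>. The inequality \<open>(a + b)^2 \<le> 2 * a^2 + 2 * b^2\<close> avoids their
  mixed moment, at the price of doubling the second moments 2 and
  \<open>4 * \<delta> / sqrt CARD('d)\<close>.\<close>

lemma energy_variance_bound:
  fixes \<theta> :: "real ^ 'd::finite"
  defines "\<delta> \<equiv> (norm \<theta>)\<^sup>2 / sqrt CARD('d)"
  shows "integrable std_gaussian (\<lambda>z. (energy (\<theta> + z) - \<delta>)\<^sup>2)"
    and "(\<integral>z. (energy (\<theta> + z) - \<delta>)\<^sup>2 \<partial>std_gaussian) \<le> 4 + 8 * \<delta> / sqrt CARD('d)"
proof -
  let ?d = "real CARD('d)"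
  have le: "(energy (\<theta> + z) - \<delta>)\<^sup>2 \<le> 2 * (energy z)\<^sup>2 + 8 / ?d * (\<theta> \<bullet> z)\<^sup>2" for z
  proof -
    have "(energy (\<theta> + z) - \<delta>)\<^sup>2 = (energy z + 2 * (\<theta> \<bullet> z) / sqrt ?d)\<^sup>2"
      by (simp add: energy_shift \<delta>_def)
    also have "\<dots> \<le> 2 * (energy z)\<^sup>2 + 2 * (2 * (\<theta> \<bullet> z) / sqrt ?d)\<^sup>2"
      using sum_squares_bound[of "energy z" "2 * (\<theta> \<bullet> z) / sqrt ?d"] by (simp add: power2_sum)
    also have "\<dots> = 2 * (energy z)\<^sup>2 + 8 / ?d * (\<theta> \<bullet> z)\<^sup>2"
      by (simp add: power_divide power_mult_distrib)
    finally show ?thesis .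
  qed
  have int: "integrable std_gaussian (\<lambda>z. 2 * (energy z)\<^sup>2 + 8 / ?d * (\<theta> \<bullet> z)\<^sup>2)"
    by (intro Bochner_Integration.integrable_add integrable_mult_right
        std_gaussian_energy_moments(3)[where 'd='d] std_gaussian_inner_moments(3))
  show *: "integrable std_gaussian (\<lambda>z. (energy (\<theta> + z) - \<delta>)\<^sup>2)"
    by (rule Bochner_Integration.integrable_bound[OF int]) (use le in \<open>auto intro: order_trans[OF _ abs_ge_self]\<close>)
  have "(\<integral>z. (energy (\<theta> + z) - \<delta>)\<^sup>2 \<partial>std_gaussian) \<le>
      (\<integral>z. 2 * (energy z)\<^sup>2 + 8 / ?d * (\<theta> \<bullet> z)\<^sup>2 \<partial>std_gaussian)"
    using * int le by (intro integral_mono)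
  also have "\<dots> = 4 + 8 / ?d * (norm \<theta>)\<^sup>2"
    using std_gaussian_energy_moments(3,4)[where 'd='d] std_gaussian_inner_moments(3,4)[of \<theta>] by simp
  also have "8 / ?d * (norm \<theta>)\<^sup>2 = 8 * \<delta> / sqrt ?d"
    by (simp add: \<delta>_def)
  finally show "(\<integral>z. (energy (\<theta> + z) - \<delta>)\<^sup>2 \<partial>std_gaussian) \<le> 4 + 8 * \<delta> / sqrt ?d" .
qed

text \<open>Chebyshev's inequality, in pointwise form before integration: exceeding \<open>x\<close>
  under the null forces \<open>energy z^2 \<ge> x^2\<close>, and staying below \<open>x\<close>
  under the alternative forces a deviation of at least \<open>\<delta> - x\<close> from
  \<delta>.\<close>

lemma energy_threshold_probabilities:
  fixes \<theta> :: "real ^ 'd::finite" and x :: real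
  defines "\<delta> \<equiv> (norm \<theta>)\<^sup>2 / sqrt CARD('d)"
  assumes x: "x > 0"
  shows "(\<integral>z. of_bool (energy z \<ge> x) \<partial>(std_gaussian :: (real ^ 'd) measure)) \<le> 2 / x\<^sup>2"
    and "\<delta> > x \<Longrightarrow>
      (\<integral>z. of_bool (energy (\<theta> + z) \<ge> x) \<partial>std_gaussian) \<ge> 1 - (4 + 8 * \<delta> / sqrt CARD('d)) / (\<delta> - x)\<^sup>2"
proof -
  interpret G: prob_space "std_gaussian :: (real ^ 'd) measure" by (rule prob_space_std_gaussian)
  have int: "integrable std_gaussian (\<lambda>z. of_bool (energy (v + z) \<ge> x) :: real)" for v :: "real ^ 'd"
    by (rule G.integrable_const_bound[where B=1]) auto
  have "of_bool (energy z \<ge> x) \<le> (energy z)\<^sup>2 / x\<^sup>2" for z :: "real ^ 'd"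
    using x by (auto simp: of_bool_def intro: power_mono)
  then have "(\<integral>z. of_bool (energy z \<ge> x) \<partial>(std_gaussian :: (real ^ 'd) measure))
      \<le> (\<integral>z. (energy z)\<^sup>2 / x\<^sup>2 \<partial>(std_gaussian :: (real ^ 'd) measure))"
    using int[of 0] std_gaussian_energy_moments(3)[where 'd='d] by (intro integral_mono) auto
  then show "(\<integral>z. of_bool (energy z \<ge> x) \<partial>(std_gaussian :: (real ^ 'd) measure)) \<le> 2 / x\<^sup>2"
    by (simp add: std_gaussian_energy_moments[where 'd='d])
  assume \<delta>: "\<delta> > x"
  have "1 - (energy (\<theta> + z) - \<delta>)\<^sup>2 / (\<delta> - x)\<^sup>2 \<le> of_bool (energy (\<theta> + z) \<ge> x)" for z
  proof (cases "energy (\<theta> + z) \<ge> x")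
    case False
    then have "(\<delta> - x)\<^sup>2 \<le> (\<delta> - energy (\<theta> + z))\<^sup>2"
      using \<delta> by (intro power_mono) auto
    with False \<delta> show ?thesis by (simp add: power2_commute field_simps)
  qed simp
  then have "(\<integral>z. 1 - (energy (\<theta> + z) - \<delta>)\<^sup>2 / (\<delta> - x)\<^sup>2 \<partial>std_gaussian) \<le>
      (\<integral>z. of_bool (energy (\<theta> + z) \<ge> x) \<partial>std_gaussian)"
    using int energy_variance_bound(1)[of \<theta>] by (intro integral_mono) (auto simp: \<delta>_def)
  also have "(\<integral>z. 1 - (energy (\<theta> + z) - \<delta>)\<^sup>2 / (\<delta> - x)\<^sup>2 \<partial>std_gaussian) =
      1 - (\<integral>z. (energy (\<theta> + z) - \<delta>)\<^sup>2 \<partial>std_gaussian) / (\<delta> - x)\<^sup>2"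
    using energy_variance_bound(1)[of \<theta>] G.prob_space by (simp add: \<delta>_def)
  finally show "(\<integral>z. of_bool (energy (\<theta> + z) \<ge> x) \<partial>std_gaussian) \<ge> 1 - (4 + 8 * \<delta> / sqrt CARD('d)) / (\<delta> - x)\<^sup>2"
    using energy_variance_bound(2)[of \<theta>] divide_right_mono[of _ "4 + 8 * \<delta> / sqrt CARD('d)" "(\<delta> - x)\<^sup>2"]
    by (fastforce simp: \<delta>_def)
qed

section \<open>The mean shift that survives clipping\<close>

definition clip :: "real \<Rightarrow> real \<Rightarrow> real" where
  "clip B x = max (- B) (min B x)"

lemma clip_measurable [measurable]: "clip B \<in> borel_measurable borel"
  unfolding clip_def[abs_def] by measurable

lemma abs_clip_le: "B \<ge> 0 \<Longrightarrow> \<bar>clip B x\<bar> \<le> B"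
  by (auto simp: clip_def)

text \<open>If neither value is clipped the increment is exact. Otherwise
  \<open>a^2 + b^2 \<ge> B^2\<close>, so the last term is at least \<open>1 / k\<close>. As clipping
  is 1-Lipschitz, the loss is at most \<open>2 * \<bar>b - a\<bar>\<close>, which is split as
  \<open>k * (b - a)^2 + 1 / k\<close>. The error is purely quadratic, so second moments control its
  mean; \<open>k\<close> remains free for balancing.\<close>

lemma clip_diff_ge:
  assumes B: "B > 0" and k: "k > 0"
  shows "clip B b - clip B a \<ge> (b - a) - k * (b - a)\<^sup>2 - (a\<^sup>2 + b\<^sup>2) / (k * B\<^sup>2)"
proof (cases "\<bar>a\<bar> \<le> B \<and> \<bar>b\<bar> \<le> B")
  case True
  then have "clip B b - clip B a = b - a" by (auto simp: clip_def)
  moreover have "k * (b - a)\<^sup>2 \<ge> 0" "(a\<^sup>2 + b\<^sup>2) / (k * B\<^sup>2) \<ge> 0" using k by auto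
  ultimately show ?thesis by linarith
next
  case False
  then have "B\<^sup>2 \<le> a\<^sup>2 + b\<^sup>2"
    using power_mono[of B "\<bar>a\<bar>" 2] power_mono[of B "\<bar>b\<bar>" 2] B
    by (auto intro: add_increasing add_increasing2)
  then have "1 / k \<le> (a\<^sup>2 + b\<^sup>2) / (k * B\<^sup>2)"
    using B k by (simp add: field_simps)
  moreover have "2 * \<bar>b - a\<bar> \<le> k * (b - a)\<^sup>2 + 1 / k"
  proof -
    have "0 \<le> (k * \<bar>b - a\<bar> - 1)\<^sup>2 / k" using k by simp
    also have "\<dots> = k * (b - a)\<^sup>2 - 2 * \<bar>b - a\<bar> + 1 / k"
      using k by (simp add: power2_diff power_mult_distrib field_simps power2_eq_square)
    finally show ?thesis by simp
  qed
  moreover have "clip B b - clip B a \<ge> (b - a) - 2 * \<bar>b - a\<bar>"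
    using B by (simp add: clip_def max_def min_def abs_if)
  ultimately show ?thesis by linarith
qed

text \<open>For moderate \<delta> the increments are compared pointwise and the clipping error is at
  most half the shift. For large \<delta> the shifted energy exceeds 100 with high probability, so
  its clipped mean is large outright, while the null mean stays below a small constant.\<close>

lemma clipped_energy_gap:
  fixes \<theta> :: "real ^ 'd::finite"
  defines "\<delta> \<equiv> (norm \<theta>)\<^sup>2 / sqrt CARD('d)" and "B \<equiv> 10000"
  assumes norm: "norm \<theta> \<ge> 1" and d: "sqrt CARD('d) \<ge> 1000"
  shows "(\<integral>z. clip B (energy (\<theta> + z)) \<partial>std_gaussian) - (\<integral>z. clip B (energy z) \<partial>(std_gaussian :: (real ^ 'd) measure))
    \<ge> min \<delta> 100 / 2"
proof -
  interpret G: prob_space "std_gaussian :: (real ^ 'd) measure" by (rule prob_space_std_gaussian)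
  let ?d = "real CARD('d)"
  have int_clip: "integrable std_gaussian (\<lambda>z. clip B (energy (v + z)))" for v :: "real ^ 'd"
    using abs_clip_le[of B] by (intro G.integrable_const_bound[where B=B]) (auto simp: B_def)
  have int_clip0: "integrable std_gaussian (\<lambda>z :: real ^ 'd. clip B (energy z))"
    using int_clip[of 0] by simp
  have "norm \<theta> > 0" using norm by linarith
  then have \<delta>: "\<delta> > 0" by (simp add: \<delta>_def)
  show ?thesis
  proof (cases "\<delta> \<le> 200")
    case True
    \<comment> \<open>Chosen so that \<open>k * (5 * \<delta>^2)\<close>, which bounds the first
      error term in mean, equals \<open>\<delta> / 4\<close>.\<close>
    define k where "k = 1 / (20 * \<delta>)"
    have k: "k > 0" using \<delta> by (simp add: k_def)
    define D where "D z = \<delta> + 2 / sqrt ?d * (\<theta> \<bullet> z)" for z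
    have shift: "energy (\<theta> + z) = energy z + D z" for z
      by (simp add: energy_shift D_def \<delta>_def)
    have D2: "(D z)\<^sup>2 = \<delta>\<^sup>2 + (4 * \<delta> / sqrt ?d) * (\<theta> \<bullet> z) + (4 / ?d) * (\<theta> \<bullet> z)\<^sup>2" for z
      by (simp add: D_def power2_sum power_mult_distrib power_divide)
    have intD: "integrable std_gaussian D" and ED: "(\<integral>z. D z \<partial>std_gaussian) = \<delta>"
      using std_gaussian_inner_moments[of \<theta>] G.prob_space by (simp_all add: D_def[abs_def])
    have intD2: "integrable std_gaussian (\<lambda>z. (D z)\<^sup>2)"
      and "(\<integral>z. (D z)\<^sup>2 \<partial>std_gaussian) = \<delta>\<^sup>2 + 4 / ?d * (norm \<theta>)\<^sup>2"
      unfolding D2 using std_gaussian_inner_moments[of \<theta>] G.prob_space by simp_all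
    \<comment> \<open>Here \<open>norm \<theta> \<ge> 1\<close> enters: it makes the variance of the
      linear term in \<open>D\<close> at most a multiple of \<open>\<delta>^2\<close>.\<close>
    moreover have "(norm \<theta>)\<^sup>2 / ?d \<le> \<delta>\<^sup>2"
    proof -
      have "(norm \<theta>)\<^sup>2 * 1 \<le> (norm \<theta>)\<^sup>2 * (norm \<theta>)\<^sup>2"
        using norm by (intro mult_left_mono) auto
      then show ?thesis
        by (simp add: \<delta>_def power_divide divide_right_mono power2_eq_square)
    qed
    ultimately have ED2: "(\<integral>z. (D z)\<^sup>2 \<partial>std_gaussian) \<le> 5 * \<delta>\<^sup>2" by simp
    define c where "c = k * B\<^sup>2"
    have c: "c > 0" using k by (simp add: c_def B_def)
    have "D z - k * (D z)\<^sup>2 - (3 * (energy z)\<^sup>2 + 2 * (D z)\<^sup>2) / c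
        \<le> clip B (energy (\<theta> + z)) - clip B (energy z)" for z
    proof -
      have "(energy z + D z)\<^sup>2 \<le> 2 * (energy z)\<^sup>2 + 2 * (D z)\<^sup>2"
        using sum_squares_bound[of "energy z" "D z"] by (simp add: power2_sum)
      then have "((energy z)\<^sup>2 + (energy z + D z)\<^sup>2) / c \<le> (3 * (energy z)\<^sup>2 + 2 * (D z)\<^sup>2) / c"
        using c by (intro divide_right_mono) auto
      moreover have "clip B (energy z + D z) - clip B (energy z) \<ge>
          D z - k * (D z)\<^sup>2 - ((energy z)\<^sup>2 + (energy z + D z)\<^sup>2) / c"
        using clip_diff_ge[OF _ k, of B "energy z + D z" "energy z"] by (simp add: B_def c_def)
      ultimately show ?thesis unfolding shift by linarith
    qed
    then have "(\<integral>z. D z - k * (D z)\<^sup>2 - (3 * (energy z)\<^sup>2 + 2 * (D z)\<^sup>2) / c \<partial>std_gaussian)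
        \<le> (\<integral>z. clip B (energy (\<theta> + z)) - clip B (energy z) \<partial>std_gaussian)"
      using intD intD2 std_gaussian_energy_moments(3)[where 'd='d] int_clip int_clip0
      by (intro integral_mono) auto
    moreover have "(\<integral>z. D z - k * (D z)\<^sup>2 - (3 * (energy z)\<^sup>2 + 2 * (D z)\<^sup>2) / c \<partial>std_gaussian) =
        \<delta> - k * (\<integral>z. (D z)\<^sup>2 \<partial>std_gaussian) - (6 + 2 * (\<integral>z. (D z)\<^sup>2 \<partial>std_gaussian)) / c"
      using intD intD2 std_gaussian_energy_moments(3,4)[where 'd='d] by (simp add: ED)
    moreover have "(\<integral>z. clip B (energy (\<theta> + z)) - clip B (energy z) \<partial>std_gaussian) =
        (\<integral>z. clip B (energy (\<theta> + z)) \<partial>std_gaussian) - (\<integral>z. clip B (energy z) \<partial>(std_gaussian :: (real ^ 'd) measure))"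
      using int_clip int_clip0 by simp
    moreover have "k * (\<integral>z. (D z)\<^sup>2 \<partial>std_gaussian) \<le> \<delta> / 4"
    proof -
      have "k * (\<integral>z. (D z)\<^sup>2 \<partial>std_gaussian) \<le> k * (5 * \<delta>\<^sup>2)"
        using k ED2 by (intro mult_left_mono) auto
      also have "\<dots> = \<delta> / 4" using \<delta> by (simp add: k_def power2_eq_square)
      finally show ?thesis .
    qed
    moreover have "(6 + 2 * (\<integral>z. (D z)\<^sup>2 \<partial>std_gaussian)) / c \<le> \<delta> / 4"
    proof -
      have "\<delta>\<^sup>2 \<le> 200\<^sup>2" using True \<delta> by (intro power_mono) auto
      then have "(6 + 2 * (\<integral>z. (D z)\<^sup>2 \<partial>std_gaussian)) / c \<le> 400006 / c"
        using ED2 c by (intro divide_right_mono) auto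
      \<comment> \<open>Since \<open>c = 5 * 10^6 / \<delta>\<close>, the bound is about
        \<open>0.08 * \<delta>\<close>; this is what the large clipping level \<open>B\<close> is
        for.\<close>
      also have "\<dots> \<le> \<delta> / 4" using \<delta> by (simp add: c_def k_def B_def)
      finally show ?thesis .
    qed
    moreover have "min \<delta> 100 \<le> \<delta>" by simp
    ultimately show ?thesis by linarith
  next
    case False
    \<comment> \<open>A quadratic minorant of the clipped energy: when the energy is below 100 the
      squared ratio is at least 1, and \<open>100 - 10100\<close> is the lowest clipped
      value.\<close>
    have pt: "100 - 10100 / (\<delta> - 100)\<^sup>2 * (energy (\<theta> + z) - \<delta>)\<^sup>2 \<le> clip B (energy (\<theta> + z))" for z
    proof (cases "energy (\<theta> + z) \<ge> 100")
      case True
      then have "clip B (energy (\<theta> + z)) \<ge> 100" by (simp add: clip_def B_def)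
      moreover have "10100 / (\<delta> - 100)\<^sup>2 * (energy (\<theta> + z) - \<delta>)\<^sup>2 \<ge> 0" by simp
      ultimately show ?thesis by linarith
    next
      case small: False
      have "(\<delta> - 100)\<^sup>2 \<le> (\<delta> - energy (\<theta> + z))\<^sup>2"
        using False small by (intro power_mono) auto
      then have "10100 \<le> 10100 / (\<delta> - 100)\<^sup>2 * (energy (\<theta> + z) - \<delta>)\<^sup>2"
        using False by (simp add: power2_commute field_simps)
      moreover have "clip B (energy (\<theta> + z)) \<ge> - 10000" by (simp add: clip_def B_def)
      ultimately show ?thesis by linarith
    qed
    have V: "integrable std_gaussian (\<lambda>z. (energy (\<theta> + z) - \<delta>)\<^sup>2)"
      "(\<integral>z. (energy (\<theta> + z) - \<delta>)\<^sup>2 \<partial>std_gaussian) \<le> 4 + 8 * \<delta> / sqrt ?d"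
      using energy_variance_bound[of \<theta>] by (simp_all add: \<delta>_def)
    have "(\<integral>z. 100 - 10100 / (\<delta> - 100)\<^sup>2 * (energy (\<theta> + z) - \<delta>)\<^sup>2 \<partial>std_gaussian)
        \<le> (\<integral>z. clip B (energy (\<theta> + z)) \<partial>std_gaussian)"
      using pt V(1) int_clip by (intro integral_mono) auto
    moreover have "(\<integral>z. 100 - 10100 / (\<delta> - 100)\<^sup>2 * (energy (\<theta> + z) - \<delta>)\<^sup>2 \<partial>std_gaussian) =
        100 - 10100 / (\<delta> - 100)\<^sup>2 * (\<integral>z. (energy (\<theta> + z) - \<delta>)\<^sup>2 \<partial>std_gaussian)"
      using V(1) G.prob_space by simp
    moreover have "10100 / (\<delta> - 100)\<^sup>2 * (\<integral>z. (energy (\<theta> + z) - \<delta>)\<^sup>2 \<partial>std_gaussian) \<le> 40"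
    proof -
      have "8 * \<delta> / sqrt ?d \<le> 8 * \<delta> / 1000"
        using d \<delta> by (intro divide_left_mono) auto
      then have "(\<integral>z. (energy (\<theta> + z) - \<delta>)\<^sup>2 \<partial>std_gaussian) \<le> \<delta> / 20"
        using V(2) False by linarith
      \<comment> \<open>Uses \<open>\<delta> - 100 \<ge> \<delta> / 2\<close>, valid because
        \<open>\<delta> > 200\<close>.\<close>
      then have "10100 / (\<delta> - 100)\<^sup>2 * (\<integral>z. (energy (\<theta> + z) - \<delta>)\<^sup>2 \<partial>std_gaussian)
          \<le> 10100 / (\<delta> / 2)\<^sup>2 * (\<delta> / 20)"
        using False by (intro mult_mono divide_left_mono power_mono) auto
      also have "\<dots> = 2020 / \<delta>" using \<delta> by (simp add: power2_eq_square)
      also have "\<dots> \<le> 40" using False by (simp add: field_simps)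
      finally show ?thesis .
    qed
    \<comment> \<open>With the loss of at most 40 above and the null mean at most
      \<open>3 / 2\<close>, the gap is at least \<open>100 - 40 - 3 / 2\<close>, more than the
      required 50.\<close>
    moreover have "(\<integral>z. clip B (energy z) \<partial>(std_gaussian :: (real ^ 'd) measure)) \<le>
        (\<integral>z. (1 + (energy z)\<^sup>2) / 2 \<partial>(std_gaussian :: (real ^ 'd) measure))"
    proof (intro integral_mono int_clip0)
      show "clip B (energy z) \<le> (1 + (energy z)\<^sup>2) / 2" for z :: "real ^ 'd"
      proof -
        have "clip B (energy z) \<le> \<bar>energy z\<bar>" by (auto simp: clip_def B_def)
        also have "\<dots> \<le> (1 + (energy z)\<^sup>2) / 2"
          using zero_le_power2[of "\<bar>energy z\<bar> - 1"] by (simp add: power2_diff)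
        finally show ?thesis .
      qed
    qed (use std_gaussian_energy_moments(3)[where 'd='d] in auto)
    moreover have "(\<integral>z. (1 + (energy z)\<^sup>2) / 2 \<partial>(std_gaussian :: (real ^ 'd) measure)) = 3 / 2"
      using std_gaussian_energy_moments(3,4)[where 'd='d] G.prob_space by simp
    ultimately show ?thesis using \<delta> by (simp add: min_def)
  qed
qed

section \<open>The three regimes\<close>

lemma std_gaussian_rescale_integral:
  fixes \<mu> :: "real ^ 'd::finite"
  assumes "s > 0"
  shows "(\<integral>z. F ((\<mu> + s *\<^sub>R z) /\<^sub>R s) \<partial>std_gaussian) = (\<integral>z. F (\<mu> /\<^sub>R s + z) \<partial>std_gaussian)"
  using assms by (simp add: scaleR_add_right)

text \<open>The threshold \<open>50 / \<alpha>\<close> is half of the guaranteed shift, so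
  Chebyshev's inequality bounds each error by \<open>\<alpha> / 2\<close>.\<close>

lemma energy_test_single_machine:
  fixes \<alpha> \<rho> :: real and m n :: nat
  assumes m: "m > 0" and n: "n > 0" and \<alpha>: "0 < \<alpha>" "\<alpha> < 1"
    and signal: "\<And>\<mu> :: real ^ 'd::finite. norm \<mu> \<ge> \<rho> \<Longrightarrow>
      (norm \<mu>)\<^sup>2 * n / m / sqrt CARD('d) \<ge> 100 / \<alpha>"
  shows "\<exists>T \<in> (distributed_tests m :: 'd dist_test set). test_risk m n \<rho> T \<le> \<alpha>"
proof -
  define s where "s = sqrt (m / n)"
  have s: "s > 0" "s\<^sup>2 = m / n" using m n by (simp_all add: s_def)
  let ?f = "\<lambda>(x :: real ^ 'd) (u :: real ^ 'd). of_bool (energy (x /\<^sub>R s) \<ge> 50 / \<alpha>) :: real"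
  have f: "(\<lambda>(x, u). ?f x u) \<in> borel_measurable (borel \<Otimes>\<^sub>M borel)"
    unfolding case_prod_beta by measurable
  have "test_risk m n \<rho> (bit_test ?f (\<lambda>t. t 0)) \<le> \<alpha> / 2 + \<alpha> / 2"
  proof (rule single_machine_test_risk[OF f _ m])
    have "(\<integral>z. ?f (sqrt (m / n) *\<^sub>R z) u \<partial>std_gaussian) \<le> 2 / (50 / \<alpha>)\<^sup>2" for u
      using energy_threshold_probabilities(1)[of "50 / \<alpha>", where 'd='d] \<alpha> s by (simp flip: s_def)
    also have "2 / (50 / \<alpha>)\<^sup>2 \<le> \<alpha> / 2"
      using \<alpha> mult_left_le[of \<alpha> \<alpha>] by (simp add: power2_eq_square)
    finally show "(\<integral>z. ?f (sqrt (m / n) *\<^sub>R z) u \<partial>std_gaussian) \<le> \<alpha> / 2" for u .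
  next
    fix \<mu> u :: "real ^ 'd" assume \<mu>: "norm \<mu> \<ge> \<rho>"
    define \<delta> where "\<delta> = (norm (\<mu> /\<^sub>R s))\<^sup>2 / sqrt CARD('d)"
    have "(norm (\<mu> /\<^sub>R s))\<^sup>2 = (norm \<mu>)\<^sup>2 * n / m"
      using s by (simp add: power_mult_distrib power_inverse divide_inverse)
    then have \<delta>: "\<delta> \<ge> 100 / \<alpha>" using signal[OF \<mu>] by (simp add: \<delta>_def)
    then have \<delta>': "\<delta> / 2 \<le> \<delta> - 50 / \<alpha>" by simp
    have "100 / \<alpha> \<ge> 100" using \<alpha> by (simp add: field_simps)
    then have pos: "\<delta> \<ge> 100" using \<delta> by simp
    \<comment> \<open>With \<open>\<delta> \<ge> 100\<close> the numerator
      \<open>4 + 8 * \<delta> / sqrt CARD('d)\<close> is at most \<open>9 * \<delta>\<close>,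
      whatever the dimension.\<close>
    have "8 * \<delta> / sqrt CARD('d) \<le> 8 * \<delta> / 1"
      using pos by (intro divide_left_mono) (auto simp: Suc_leI)
    then have "(4 + 8 * \<delta> / sqrt CARD('d)) / (\<delta> - 50 / \<alpha>)\<^sup>2 \<le> (9 * \<delta>) / (\<delta> / 2)\<^sup>2"
      using \<delta>' pos by (intro frac_le power_mono) auto
    also have "\<dots> = 36 / \<delta>" using pos by (simp add: power2_eq_square)
    also have "\<dots> \<le> 36 / (100 / \<alpha>)"
      using \<delta> \<alpha> pos by (intro divide_left_mono) auto
    also have "\<dots> \<le> \<alpha> / 2" using \<alpha> by simp
    finally have "1 - \<alpha> / 2 \<le> 1 - (4 + 8 * \<delta> / sqrt CARD('d)) / (\<delta> - 50 / \<alpha>)\<^sup>2"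
      by simp
    also have "\<dots> \<le> (\<integral>z. of_bool (energy (\<mu> /\<^sub>R s + z) \<ge> 50 / \<alpha>) \<partial>std_gaussian)"
    proof -
      have "50 / \<alpha> < \<delta>" "50 / \<alpha> > 0" using \<delta>' pos \<alpha> by (linarith, simp)
      then show ?thesis unfolding \<delta>_def by (intro energy_threshold_probabilities(2))
    qed
    also have "\<dots> = (\<integral>z. ?f (\<mu> + sqrt (m / n) *\<^sub>R z) u \<partial>std_gaussian)"
      unfolding s_def[symmetric]
      by (rule std_gaussian_rescale_integral[OF s(1), where F="\<lambda>y. of_bool (energy y \<ge> 50 / \<alpha>)", symmetric])
    finally show "1 - \<alpha> / 2 \<le> (\<integral>z. ?f (\<mu> + sqrt (m / n) *\<^sub>R z) u \<partial>std_gaussian)" .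
  qed (use \<alpha> in auto)
  then show ?thesis
    by (intro bexI[OF _ bit_test_in_distributed_tests[OF f]]) auto
qed

section \<open>Many machines, fewer than the dimension: clipped energies\<close>

text \<open>Fixes the rejection threshold of both counting tests: with
  \<open>\<tau>^2 = m * L / 2\<close> and \<open>L = ln (16 / \<alpha>)\<close>, the two Hoeffding
  bounds together cost \<open>4 * (\<alpha> / 16)\<close>.\<close>

lemma exp_level:
  fixes \<alpha> :: real and m :: nat
  assumes "m > 0" "0 < \<alpha>" "\<alpha> < 1"
  shows "4 * exp (- 2 * (sqrt (m * ln (16 / \<alpha>) / 2))\<^sup>2 / m) = \<alpha> / 4"
proof -
  have "ln (16 / \<alpha>) \<ge> 0" using assms by simp
  then have "- 2 * (sqrt (m * ln (16 / \<alpha>) / 2))\<^sup>2 / m = - ln (16 / \<alpha>)"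
    using assms by simp
  then show ?thesis using assms by (simp add: exp_minus)
qed

text \<open>Squaring removes the root from the separation \<open>2 * \<tau> / m\<close> demanded by
  the counting test, for the same threshold \<tau>.\<close>

lemma separation_iff:
  fixes L g :: real and m :: nat
  assumes "m > 0" "L \<ge> 0" "g \<ge> 0"
  shows "2 * sqrt (m * L / 2) / m \<le> g \<longleftrightarrow> 2 * L \<le> m * g\<^sup>2"
proof -
  let ?x = "2 * sqrt (m * L / 2) / m"
  have "?x\<^sup>2 = 4 * (m * L / 2) / (real m)\<^sup>2"
    using assms by (simp add: power_mult_distrib power_divide)
  also have "\<dots> = 2 * L / m"
    by (simp add: power2_eq_square)
  finally have "?x \<le> g \<longleftrightarrow> 2 * L / m \<le> g\<^sup>2"
    using power_mono_iff[of ?x g 2] assms by simp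
  then show ?thesis using assms by (simp add: field_simps)
qed

lemma clipped_energy_counting_test:
  fixes \<alpha> \<rho> L :: real and m n :: nat
  defines "L \<equiv> ln (16 / \<alpha>)"
  assumes m: "m > 0" and n: "n > 0" and \<alpha>: "0 < \<alpha>" "\<alpha> < 1"
    and large: "real m \<ge> 10 ^ 6 * L" and d: "sqrt CARD('d) \<ge> 1000"
    and signal: "\<And>\<mu> :: real ^ 'd::finite. norm \<mu> \<ge> \<rho> \<Longrightarrow>
      (norm \<mu>)\<^sup>2 * n / m \<ge> 1 \<and> m * ((norm \<mu>)\<^sup>2 * n / m / sqrt CARD('d))\<^sup>2 \<ge> 10 ^ 10 * L"
  shows "\<exists>T \<in> (distributed_tests m :: 'd dist_test set). test_risk m n \<rho> T \<le> \<alpha>"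
proof -
  define s where "s = sqrt (m / n)"
  have s: "s > 0" "s\<^sup>2 = m / n" using m n by (simp_all add: s_def)
  have L: "L \<ge> 0" using \<alpha> by (simp add: L_def)
  define B :: real where "B = 10000"
  interpret G: prob_space "std_gaussian :: (real ^ 'd) measure" by (rule prob_space_std_gaussian)
  have int_clip: "integrable std_gaussian (\<lambda>z. clip B (energy (v + z)))" for v :: "real ^ 'd"
    using abs_clip_le[of B] by (intro G.integrable_const_bound[where B=B]) (auto simp: B_def)
  \<comment> \<open>The affine map sends the clipped range \<open>{-B..B}\<close> onto the unit
    interval, so a gap in clipped energy is divided by \<open>2 * B\<close>.\<close>
  let ?g = "\<lambda>y :: real ^ 'd. 1 / 2 + clip B (energy y) / (2 * B)"
  let ?f = "\<lambda>(x :: real ^ 'd) (u :: real ^ 'd). ?g (x /\<^sub>R s)"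
  have f: "(\<lambda>(x, u). ?f x u) \<in> borel_measurable (borel \<Otimes>\<^sub>M borel)"
    unfolding case_prod_beta by measurable
  have f01: "?f x u \<in> {0..1}" for x u
    using abs_clip_le[of B "energy (x /\<^sub>R s)"] by (auto simp: B_def abs_le_iff)
  have mean: "(\<integral>z. ?g (v + z) \<partial>std_gaussian) = 1 / 2 + (\<integral>z. clip B (energy (v + z)) \<partial>std_gaussian) / (2 * B)" for v
    using int_clip[of v] G.prob_space by simp
  define \<tau> where "\<tau> = sqrt (m * L / 2)"
  define p where "p = (\<integral>z. ?g z \<partial>std_gaussian)"
  have "test_risk m n \<rho> (bit_test ?f (\<lambda>t. \<bar>bit_count m t - m * p\<bar> \<ge> \<tau>)) \<le> 4 * exp (- 2 * \<tau>\<^sup>2 / m) + 0"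
  proof (rule counting_test_risk[OF f f01 m])
    show "(\<integral>z. ?f (sqrt (m / n) *\<^sub>R z) u \<partial>std_gaussian) = p" for u
      using s by (simp add: p_def flip: s_def)
  next
    fix \<mu> :: "real ^ 'd" assume \<mu>: "norm \<mu> \<ge> \<rho>"
    define \<theta> where "\<theta> = \<mu> /\<^sub>R s"
    define \<delta> where "\<delta> = (norm \<theta>)\<^sup>2 / sqrt CARD('d)"
    have "(norm \<theta>)\<^sup>2 = (norm \<mu>)\<^sup>2 * n / m"
      using s by (simp add: \<theta>_def power_mult_distrib power_inverse divide_inverse)
    then have "(norm \<theta>)\<^sup>2 \<ge> 1" and \<delta>: "m * \<delta>\<^sup>2 \<ge> 10 ^ 10 * L"
      using signal[OF \<mu>] by (simp_all add: \<delta>_def)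
    then have "norm \<theta> \<ge> 1"
      using power2_le_imp_le[of 1 "norm \<theta>"] by simp
    then have gap: "min \<delta> 100 / 2 \<le>
        (\<integral>z. clip B (energy (\<theta> + z)) \<partial>std_gaussian) - (\<integral>z. clip B (energy z) \<partial>(std_gaussian :: (real ^ 'd) measure))"
      unfolding \<delta>_def B_def by (rule clipped_energy_gap[OF _ d])
    have "min \<delta> 100 / (4 * B) = min \<delta> 100 / 2 / (2 * B)" by simp
    also have "\<dots> \<le> ((\<integral>z. clip B (energy (\<theta> + z)) \<partial>std_gaussian) -
        (\<integral>z. clip B (energy z) \<partial>(std_gaussian :: (real ^ 'd) measure))) / (2 * B)"
      using gap by (intro divide_right_mono) (simp_all add: B_def)
    also have "\<dots> = (\<integral>z. ?g (\<theta> + z) \<partial>std_gaussian) - p"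
      unfolding p_def mean using mean[of 0] by (simp add: diff_divide_distrib)
    finally have shift: "min \<delta> 100 / (4 * B) \<le> (\<integral>z. ?g (\<theta> + z) \<partial>std_gaussian) - p" .
    \<comment> \<open>With \<open>B = 10000\<close>, a small shift uses the lower bound on
      \<open>m * \<delta>^2\<close> and a saturated shift uses the lower bound on
      \<open>m\<close>.\<close>
    have "2 * L \<le> m * (min \<delta> 100 / (4 * B))\<^sup>2"
    proof (cases "\<delta> \<le> 100")
      case True
      then show ?thesis using \<delta> L by (simp add: B_def power_divide)
    next
      case False
      then show ?thesis using large L by (simp add: B_def power_divide)
    qed
    moreover have "\<delta> \<ge> 0" by (simp add: \<delta>_def)
    then have "min \<delta> 100 / (4 * B) \<ge> 0" by (simp add: B_def)
    ultimately have "2 * \<tau> / m \<le> min \<delta> 100 / (4 * B)"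
      unfolding \<tau>_def using separation_iff[OF m L] by blast
    also note shift
    also have "(\<integral>z. ?g (\<theta> + z) \<partial>std_gaussian) = (\<integral>z. ?f (\<mu> + sqrt (m / n) *\<^sub>R z) u \<partial>std_gaussian)" for u
      unfolding \<theta>_def s_def[symmetric]
      by (rule std_gaussian_rescale_integral[OF s(1), where F="?g", symmetric])
    \<comment> \<open>The bit mean does not depend on the coin, so the set of bad coins is
      empty.\<close>
    finally show "\<exists>B. emeasure std_gaussian B \<le> ennreal 0 \<and> B \<in> sets borel \<and>
       (\<forall>u. u \<notin> B \<longrightarrow> \<bar>(\<integral>z. ?f (\<mu> + sqrt (m / n) *\<^sub>R z) u \<partial>std_gaussian) - p\<bar> \<ge> 2 * \<tau> / m)"
      by (intro exI[of _ "{}"]) auto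
  qed (use L in \<open>auto simp: \<tau>_def\<close>)
  also have "\<dots> \<le> \<alpha>"
    using exp_level[OF m \<alpha>] \<alpha> by (simp add: \<tau>_def L_def)
  finally show ?thesis
    by (intro bexI[OF _ bit_test_in_distributed_tests[OF f f01]])
qed

section \<open>At least as many machines as dimensions: random half spaces\<close>

lemma measure_std_gaussian_slab_le:
  fixes a :: "real ^ 'd::finite"
  assumes "a \<noteq> 0" "t \<ge> 0"
  shows "measure std_gaussian {u. \<bar>a \<bullet> u\<bar> \<le> t * norm a} \<le> t"
proof -
  have "measure std_gaussian {u. \<bar>a \<bullet> u\<bar> \<le> t * norm a} =
      measure (distr std_gaussian borel (\<lambda>u. a \<bullet> u / norm a)) {-t..t}"
    using assms sets_eq_imp_space_eq[OF sets_std_gaussian]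
    by (subst measure_distr) (auto simp: abs_le_iff field_simps intro!: arg_cong2[where f=measure])
  then show ?thesis
    using measure_std_normal_symmetric_le[OF assms(2)] assms(1)
    by (simp add: distr_normalized_inner_std_gaussian)
qed

text \<open>Chebyshev's inequality for the energy. As \<open>sqrt \<alpha> \<le> 1\<close>,
  subtracting the dimension leaves at least \<open>3 * CARD('d) / sqrt \<alpha>\<close>, that is, an
  energy of at least \<open>3 * sqrt (CARD('d) / \<alpha>)\<close>.\<close>

lemma measure_std_gaussian_norm_large:
  assumes "0 < \<alpha>" "\<alpha> < 1"
  shows "measure std_gaussian {u :: real ^ 'd::finite. (norm u)\<^sup>2 \<ge> 4 * real CARD('d) / sqrt \<alpha>} \<le> \<alpha> / 4"
proof -
  interpret G: prob_space "std_gaussian :: (real ^ 'd) measure" by (rule prob_space_std_gaussian)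
  have space: "space (std_gaussian :: (real ^ 'd) measure) = UNIV"
    using sets_eq_imp_space_eq[OF sets_std_gaussian] by simp
  let ?d = "real CARD('d)"
  define x where "x = 3 * sqrt (?d / \<alpha>)"
  have "sqrt \<alpha> \<le> 1" using assms by simp
  have d1: "?d \<ge> 1" by (simp add: Suc_leI)
  have sub: "energy u \<ge> x" if "(norm u)\<^sup>2 \<ge> 4 * ?d / sqrt \<alpha>" for u :: "real ^ 'd"
  proof -
    have "?d \<le> ?d / sqrt \<alpha>" using \<open>sqrt \<alpha> \<le> 1\<close> assms by (simp add: field_simps)
    then have "3 * ?d / sqrt \<alpha> \<le> (norm u)\<^sup>2 - ?d" using that by simp
    then have "3 * ?d / sqrt \<alpha> / sqrt ?d \<le> energy u"
      unfolding energy_def by (intro divide_right_mono) auto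
    also have "3 * ?d / sqrt \<alpha> / sqrt ?d = x"
    proof -
      have "3 * ?d / sqrt \<alpha> / sqrt ?d = 3 * (?d / sqrt ?d) / sqrt \<alpha>" by simp
      then show ?thesis by (simp only: real_div_sqrt of_nat_0_le_iff) (simp add: x_def real_sqrt_divide)
    qed
    finally show ?thesis .
  qed
  have "x > 0" using assms by (simp add: x_def)
  have "measure std_gaussian {u :: real ^ 'd. (norm u)\<^sup>2 \<ge> 4 * ?d / sqrt \<alpha>}
      \<le> measure std_gaussian {u :: real ^ 'd. energy u \<ge> x}"
    using sub by (intro G.finite_measure_mono) (auto simp: sets_std_gaussian)
  also have "\<dots> = (\<integral>u. of_bool (energy u \<ge> x) \<partial>(std_gaussian :: (real ^ 'd) measure))"
  proof -
    have "(\<lambda>u :: real ^ 'd. of_bool (energy u \<ge> x) :: real) = indicator {u. energy u \<ge> x}"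
      by (auto simp: indicator_def)
    then show ?thesis by (simp add: space)
  qed
  also have "\<dots> \<le> 2 / x\<^sup>2"
    by (rule energy_threshold_probabilities(1)) fact
  also have "\<dots> = 2 * \<alpha> / (9 * ?d)"
    using assms by (simp add: x_def power_mult_distrib)
  also have "\<dots> \<le> 2 * \<alpha> / (9 * 1)"
    using assms d1 by (intro divide_left_mono) auto
  also have "\<dots> \<le> \<alpha> / 4" using assms by simp
  finally show ?thesis .
qed

lemma half_space_probability:
  fixes u \<theta> :: "real ^ 'd::finite"
  assumes "u \<noteq> 0"
  shows "(\<integral>z. of_bool (u \<bullet> (\<theta> + z) \<ge> 0) \<partial>std_gaussian) =
    measure std_normal_distribution {- (u \<bullet> \<theta> / norm u)..}"
proof -
  have space: "space (std_gaussian :: (real ^ 'd) measure) = UNIV"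
    using sets_eq_imp_space_eq[OF sets_std_gaussian] by simp
  have "(\<integral>z. of_bool (u \<bullet> (\<theta> + z) \<ge> 0) \<partial>std_gaussian) =
      (\<integral>z. (indicator :: _ \<Rightarrow> _ \<Rightarrow> real) {- (u \<bullet> \<theta> / norm u)..} (u \<bullet> z / norm u) \<partial>std_gaussian)"
    using assms by (intro Bochner_Integration.integral_cong) (auto simp: indicator_def inner_add_right field_simps)
  also have "\<dots> = (\<integral>x. indicator {- (u \<bullet> \<theta> / norm u)..} x \<partial>distr std_gaussian borel (\<lambda>z. u \<bullet> z / norm u))"
    by (rule integral_distr[of "\<lambda>z. u \<bullet> z / norm u" std_gaussian borel, symmetric]) auto
  finally show ?thesis
    using assms by (simp add: distr_normalized_inner_std_gaussian)
qed

text \<open>Given the coin, the shift of the bit mean is governed by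
  \<open>t = u \<bullet> \<theta> / norm u\<close>, where
  \<open>\<theta> = \<mu> /\<^sub>R s\<close>. A coin is bad if the numerator is small or the
  denominator large; each event has probability at most \<open>\<alpha> / 4\<close>, and
  \<open>\<alpha> / 4\<close> more goes to Hoeffding's bounds.\<close>

lemma half_space_counting_test:
  fixes \<alpha> \<rho> L :: real and m n :: nat
  defines "L \<equiv> ln (16 / \<alpha>)"
  assumes m: "m > 0" and n: "n > 0" and \<alpha>: "0 < \<alpha>" "\<alpha> < 1" and \<rho>: "\<rho> > 0"
    and large: "real m \<ge> 72 * L"
    and signal: "\<And>\<mu> :: real ^ 'd::finite. norm \<mu> \<ge> \<rho> \<Longrightarrow>
      \<alpha>\<^sup>2 * sqrt \<alpha> * ((norm \<mu>)\<^sup>2 * n) \<ge> 4608 * L * CARD('d)"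
  shows "\<exists>T \<in> (distributed_tests m :: 'd dist_test set). test_risk m n \<rho> T \<le> \<alpha>"
proof -
  define s where "s = sqrt (m / n)"
  have s: "s > 0" "s\<^sup>2 = m / n" using m n by (simp_all add: s_def)
  have L: "L \<ge> 0" using \<alpha> by (simp add: L_def)
  interpret G: prob_space "std_gaussian :: (real ^ 'd) measure" by (rule prob_space_std_gaussian)
  let ?d = "real CARD('d)"
  \<comment> \<open>at \<open>u = 0\<close> every \<open>x\<close> lies in the half space, so that the null mean would be \<open>1\<close> instead of \<open>1 / 2\<close>\<close>
  let ?f = "\<lambda>(x :: real ^ 'd) (u :: real ^ 'd). if u = 0 then 1 / 2 else of_bool (u \<bullet> (x /\<^sub>R s) \<ge> 0) :: real"
  have f: "(\<lambda>(x, u). ?f x u) \<in> borel_measurable (borel \<Otimes>\<^sub>M borel)"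
    unfolding case_prod_beta by measurable
  have f01: "?f x u \<in> {0..1}" for x u by simp
  define \<tau> where "\<tau> = sqrt (m * L / 2)"
  have "test_risk m n \<rho> (bit_test ?f (\<lambda>t. \<bar>bit_count m t - m * (1 / 2)\<bar> \<ge> \<tau>))
      \<le> 4 * exp (- 2 * \<tau>\<^sup>2 / m) + \<alpha> / 2"
  proof (rule counting_test_risk[OF f f01 m])
    show "(\<integral>z. ?f (sqrt (m / n) *\<^sub>R z) u \<partial>std_gaussian) = 1 / 2" for u
    proof (cases "u = 0")
      case True
      then show ?thesis using G.prob_space by simp
    next
      case False
      then show ?thesis
        using half_space_probability[of u 0] s by (simp add: measure_std_normal_nonneg flip: s_def)
    qed
  next
    fix \<mu> :: "real ^ 'd" assume \<mu>: "norm \<mu> \<ge> \<rho>"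
    then have \<mu>0: "\<mu> \<noteq> 0" using \<rho> by auto
    let ?B1 = "{u. \<bar>\<mu> \<bullet> u\<bar> \<le> \<alpha> / 4 * norm \<mu>}" and ?B2 = "{u :: real ^ 'd. (norm u)\<^sup>2 \<ge> 4 * ?d / sqrt \<alpha>}"
    have "G.prob (?B1 \<union> ?B2) \<le> G.prob ?B1 + G.prob ?B2"
      by (intro measure_Un_le) (auto simp: sets_std_gaussian)
    also have "\<dots> \<le> \<alpha> / 2"
      using measure_std_gaussian_slab_le[OF \<mu>0, of "\<alpha> / 4"] measure_std_gaussian_norm_large[OF \<alpha>, where 'd='d] \<alpha>
      by simp
    finally have small: "emeasure std_gaussian (?B1 \<union> ?B2) \<le> ennreal (\<alpha> / 2)"
      by (simp add: G.emeasure_eq_measure ennreal_leI)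
    have "\<bar>(\<integral>z. ?f (\<mu> + sqrt (m / n) *\<^sub>R z) u \<partial>std_gaussian) - 1 / 2\<bar> \<ge> 2 * \<tau> / m"
      if u: "u \<notin> ?B1 \<union> ?B2" for u
    proof -
      have u0: "u \<noteq> 0" using u \<alpha> by auto
      define t where "t = u \<bullet> (\<mu> /\<^sub>R s) / norm u"
      have "(\<integral>z. ?f (\<mu> + sqrt (m / n) *\<^sub>R z) u \<partial>std_gaussian) =
          (\<integral>z. of_bool (u \<bullet> (\<mu> /\<^sub>R s + z) \<ge> 0) \<partial>std_gaussian)"
        using u0 std_gaussian_rescale_integral[OF s(1), where F="\<lambda>y. of_bool (u \<bullet> y \<ge> 0)" and \<mu>=\<mu>]
        by (simp flip: s_def)
      also have "\<dots> = measure std_normal_distribution {- t..}"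
        unfolding t_def by (rule half_space_probability[OF u0])
      finally have "min \<bar>t\<bar> 1 / 6 \<le> \<bar>(\<integral>z. ?f (\<mu> + sqrt (m / n) *\<^sub>R z) u \<partial>std_gaussian) - 1 / 2\<bar>"
        using measure_std_normal_tail_gap[of t] by simp
      moreover have "2 * \<tau> / m \<le> min \<bar>t\<bar> 1 / 6"
      proof -
        \<comment> \<open>The factor \<open>1 / 6\<close> of the normal tail gap turns the
          requirement into \<open>72 * L \<le> m * min \<bar>t\<bar> 1^2\<close>, which explains the
          hypothesis on \<open>m\<close>.\<close>
        have "2 * L \<le> m * (min \<bar>t\<bar> 1 / 6)\<^sup>2"
        proof (cases "\<bar>t\<bar> \<le> 1")
          case False
          then show ?thesis using large by (simp add: power_divide)
        next
          case True
          have "(\<alpha> / 4 * norm \<mu>)\<^sup>2 \<le> (\<mu> \<bullet> u)\<^sup>2"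
            using u \<alpha> by (intro abs_le_square_iff[THEN iffD1]) auto
          moreover have "(norm u)\<^sup>2 \<le> 4 * ?d / sqrt \<alpha>" using u by simp
          moreover have "t\<^sup>2 = (\<mu> \<bullet> u)\<^sup>2 * n / m / (norm u)\<^sup>2"
            using s by (simp add: t_def power_divide power_mult_distrib power_inverse inner_commute divide_inverse)
          ultimately have "(\<alpha> / 4 * norm \<mu>)\<^sup>2 * n / m / (4 * ?d / sqrt \<alpha>) \<le> t\<^sup>2"
            by (simp only:) (rule frac_le; use u0 in \<open>simp add: divide_right_mono mult_right_mono\<close>)
          \<comment> \<open>The slab width contributes \<open>\<alpha>^2 / 16\<close> and the norm
            bound \<open>sqrt \<alpha> / 4\<close>; hence the constant \<open>4608 = 64 * 72\<close>
            in the signal condition.\<close>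
          also have "(\<alpha> / 4 * norm \<mu>)\<^sup>2 * n / m / (4 * ?d / sqrt \<alpha>) =
              \<alpha>\<^sup>2 * sqrt \<alpha> * ((norm \<mu>)\<^sup>2 * n) / (64 * m * ?d)"
            by (simp add: power_mult_distrib power_divide mult_ac)
          finally have "4608 * L * ?d / (64 * m * ?d) \<le> t\<^sup>2"
            using signal[OF \<mu>] divide_right_mono[of "4608 * L * ?d" _ "64 * m * ?d"] by fastforce
          then have "72 * L / m \<le> t\<^sup>2" by simp
          then show ?thesis
            using True m by (simp add: power_divide field_simps)
        qed
        then show ?thesis unfolding \<tau>_def using separation_iff[OF m L, of "min \<bar>t\<bar> 1 / 6"] by simp
      qed
      ultimately show ?thesis by linarith
    qed
    then show "\<exists>B. emeasure std_gaussian B \<le> ennreal (\<alpha> / 2) \<and> B \<in> sets borel \<and>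
       (\<forall>u. u \<notin> B \<longrightarrow> \<bar>(\<integral>z. ?f (\<mu> + sqrt (m / n) *\<^sub>R z) u \<partial>std_gaussian) - 1 / 2\<bar> \<ge> 2 * \<tau> / m)"
      using small by (intro exI[of _ "?B1 \<union> ?B2"]) auto
  qed (use L \<alpha> in \<open>auto simp: \<tau>_def\<close>)
  also have "\<dots> \<le> \<alpha>"
    using exp_level[OF m \<alpha>] \<alpha> by (simp add: \<tau>_def L_def)
  finally show ?thesis
    by (intro bexI[OF _ bit_test_in_distributed_tests[OF f f01]])
qed

section \<open>Lower bounds for the constant\<close>

lemma ln_16_div_ge_1:
  assumes "0 < \<alpha>" "\<alpha> < (1::real)"
  shows "ln (16 / \<alpha>) \<ge> 1"
proof -
  have "\<alpha> * exp 1 \<le> 1 * 3"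
    using exp_le assms by (intro mult_mono) auto
  then have "exp 1 \<le> 16 / \<alpha>"
    using assms by (simp add: field_simps)
  then show ?thesis using assms by (subst ln_ge_iff) auto
qed

text \<open>Both maxima are bounded below by their first entries. From
  \<open>16 / \<alpha> \<le> (4 / \<alpha>)^2\<close> the logarithm in \<open>kappa_bar\<close> is
  at least \<open>L / 2\<close>, so \<open>M_const\<close> is at least
  \<open>160^2 * 3 / 2 * L\<close>; the factor \<open>1 / \<alpha>\<close> comes from
  \<open>kappa\<close>.\<close>

lemma C_const_ge_inverse:
  assumes \<alpha>: "0 < \<alpha>" "\<alpha> < 1"
  shows "C_const \<alpha> \<ge> 10 ^ 10 * (ln (16 / \<alpha>))\<^sup>2 / \<alpha>"
proof -
  let ?L = "ln (16 / \<alpha>)"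
  have L: "?L \<ge> 1" using ln_16_div_ge_1[OF \<alpha>] .
  have "16 / \<alpha> \<le> (4 / \<alpha>)\<^sup>2" using \<alpha> by (simp add: field_simps power2_eq_square)
  then have "?L \<le> ln ((4 / \<alpha>)\<^sup>2)" using \<alpha> by simp
  also have "\<dots> = 2 * ln (4 / \<alpha>)" using \<alpha> by (simp add: ln_realpow)
  finally have "38400 * ?L \<le> (2 ^ 5 * 5 * kappa_bar \<alpha>)\<^sup>2"
    using L by (simp add: kappa_bar_def power_mult_distrib)
  also have "\<dots> \<le> M_const \<alpha>" unfolding M_const_def by (rule Max_ge) auto
  finally have M: "(38400 * ?L)\<^sup>2 \<le> (M_const \<alpha>)\<^sup>2" using L by (intro power_mono) auto
  have "10 ^ 10 * ?L\<^sup>2 \<le> 2 ^ 4 * (38400 * ?L)\<^sup>2 * 4"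
    by (simp add: power_mult_distrib)
  also have "\<dots> \<le> 2 ^ 4 * (M_const \<alpha>)\<^sup>2 * 4"
    using M by (intro mult_right_mono mult_left_mono) auto
  finally have "10 ^ 10 * ?L\<^sup>2 / \<alpha> \<le> 2 ^ 4 * (M_const \<alpha>)\<^sup>2 * 4 / \<alpha>"
    using \<alpha> by (intro divide_right_mono) auto
  also have "\<dots> = 2 ^ 4 * (M_const \<alpha>)\<^sup>2 * (kappa \<alpha>)\<^sup>2"
    using \<alpha> by (simp add: kappa_def)
  also have "\<dots> \<le> C_const \<alpha>" unfolding C_const_def by (rule Max_ge) auto
  finally show ?thesis .
qed

text \<open>The last entry of the maximum carries \<open>\<alpha> powr (-5 / 2)\<close>, which
  cancels \<open>\<alpha>^2 * sqrt \<alpha>\<close>; the numbers fit because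
  \<open>2^12 * 4 / 3 > 4608\<close>.\<close>

lemma C_const_ge_power:
  assumes \<alpha>: "0 < \<alpha>" "\<alpha> < 1"
  shows "\<alpha>\<^sup>2 * sqrt \<alpha> * C_const \<alpha> \<ge> 4608 * ln (16 / \<alpha>)"
proof -
  let ?L = "ln (16 / \<alpha>)"
  have L: "?L \<ge> 1" using ln_16_div_ge_1[OF \<alpha>] .
  have pow: "\<alpha>\<^sup>2 * sqrt \<alpha> * \<alpha> powr (-5 / 2) = 1"
  proof -
    have "\<alpha>\<^sup>2 * sqrt \<alpha> * \<alpha> powr (-5 / 2) = \<alpha> powr 2 * \<alpha> powr (1 / 2) * \<alpha> powr (-5 / 2)"
      using \<alpha> by (simp add: powr_half_sqrt)
    also have "\<dots> = \<alpha> powr (2 + 1 / 2 + -5 / 2)"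
      by (simp only: powr_add)
    finally show ?thesis using \<alpha> by simp
  qed
  have "2\<^sup>2 \<le> (exp 1 :: real)\<^sup>2"
    using exp_ge_add_one_self[of 1] by (intro power_mono) auto
  then have "4608 * ?L \<le> 2 ^ 12 * (exp 1)\<^sup>2 * (?L / 3)"
    using L mult_right_mono[of 4 "(exp 1)\<^sup>2" "?L"] by simp
  also have "\<dots> = \<alpha>\<^sup>2 * sqrt \<alpha> * \<alpha> powr (-5 / 2) * (2 ^ 12 * (exp 1)\<^sup>2 * (kappa_tilde \<alpha>)\<^sup>2)"
    using L by (simp only: pow) (simp add: kappa_tilde_def)
  also have "\<dots> = \<alpha>\<^sup>2 * sqrt \<alpha> * (2 ^ 12 * (exp 1)\<^sup>2 * (kappa_tilde \<alpha>)\<^sup>2 * \<alpha> powr (-5 / 2))"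
    by (simp add: mult_ac)
  also have "\<dots> \<le> \<alpha>\<^sup>2 * sqrt \<alpha> * C_const \<alpha>"
    unfolding C_const_def using \<alpha> by (intro mult_left_mono Max_ge) auto
  finally show ?thesis .
qed

section \<open>Splitting by the sizes of the number of machines and the dimension\<close>

theorem theorem2:
  fixes m n :: nat and \<alpha> \<rho> :: real
  assumes "m > 0" and "n > 0"
    and "0 < \<alpha>" and "\<alpha> < 1"
    and "\<rho> > 0"
    and "\<rho>\<^sup>2 \<ge> C_const \<alpha> * sqrt (real CARD('d) * real (min m CARD('d))) / real n"
  shows "\<exists>T \<in> (distributed_tests m :: ('d::finite) dist_test set). test_risk m n \<rho> T \<le> \<alpha>"
proof -
  define L where "L = ln (16 / \<alpha>)"
  define C where "C = C_const \<alpha>"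
  let ?d = "real CARD('d)"
  have L: "L \<ge> 1" using ln_16_div_ge_1 assms by (simp add: L_def)
  have d: "?d \<ge> 1" by (simp add: Suc_leI)
  have C: "C \<ge> 10 ^ 10 * L\<^sup>2 / \<alpha>"
    using C_const_ge_inverse assms by (simp add: L_def C_def)
  have "L \<le> L\<^sup>2" using L self_le_power[of L 2] by simp
  have "10 ^ 10 * L \<le> 10 ^ 10 * L\<^sup>2 / 1" using \<open>L \<le> L\<^sup>2\<close> by simp
  also have "\<dots> \<le> 10 ^ 10 * L\<^sup>2 / \<alpha>" using assms by (intro divide_left_mono) auto
  finally have C_ge_L: "C \<ge> 10 ^ 10 * L" using C by simp
  then have C1: "C \<ge> 1" using L by simp
  have signal: "(norm \<mu>)\<^sup>2 * n \<ge> C * sqrt (?d * real (min m CARD('d)))"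
    if "norm \<mu> \<ge> \<rho>" for \<mu> :: "real ^ 'd"
  proof -
    have "\<rho>\<^sup>2 \<le> (norm \<mu>)\<^sup>2" using that assms by (intro power_mono) auto
    then have "C * sqrt (?d * real (min m CARD('d))) / n \<le> (norm \<mu>)\<^sup>2"
      using assms(6) by (simp add: C_def)
    then show ?thesis using assms(2) by (simp add: field_simps)
  qed
  \<comment> \<open>The cutoff must be large enough for the clipped test and small enough that
    \<open>C / (10^6 * L)\<close>, at least \<open>10^4 * L / \<alpha>\<close>, still provides the
    shift \<open>100 / \<alpha>\<close> for one machine.\<close>
  consider "real m < 10 ^ 6 * L" | "real m \<ge> 10 ^ 6 * L" "m < CARD('d)" | "real m \<ge> 10 ^ 6 * L" "CARD('d) \<le> m"
    by linarith
  then show ?thesis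
  proof cases
    case 1
    show ?thesis
    proof (rule energy_test_single_machine[OF assms(1-4)])
      fix \<mu> :: "real ^ 'd" assume \<mu>: "norm \<mu> \<ge> \<rho>"
      have "100 / \<alpha> \<le> 10 ^ 4 * L / \<alpha>" using L assms by (intro divide_right_mono) auto
      also have "\<dots> = 10 ^ 10 * L\<^sup>2 / \<alpha> / (10 ^ 6 * L)" using L by (simp add: power2_eq_square)
      also have "\<dots> \<le> C / (10 ^ 6 * L)" using C L by (intro divide_right_mono) auto
      also have "\<dots> \<le> C / m" using 1 C1 assms(1) by (intro divide_left_mono) auto
      also have "\<dots> = C * sqrt (?d * 1) / m / sqrt ?d" by simp
      also have "\<dots> \<le> (norm \<mu>)\<^sup>2 * n / m / sqrt ?d"
      proof (intro divide_right_mono)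
        have "C * sqrt (?d * 1) \<le> C * sqrt (?d * real (min m CARD('d)))"
          using C1 assms(1) by (intro mult_left_mono real_sqrt_le_mono) (auto simp: Suc_leI)
        then show "C * sqrt (?d * 1) \<le> (norm \<mu>)\<^sup>2 * n" using signal[OF \<mu>] by linarith
      qed auto
      finally show "100 / \<alpha> \<le> (norm \<mu>)\<^sup>2 * n / m / sqrt ?d" .
    qed
  next
    case 2
    show ?thesis
    proof (rule clipped_energy_counting_test[OF assms(1-4)])
      have "10 ^ 6 \<le> 10 ^ 6 * L" "real m \<le> ?d" using 2 L by simp_all
      then have "10 ^ 6 \<le> ?d" using 2(1) by linarith
      then have "sqrt (1000\<^sup>2) \<le> sqrt ?d" by (intro real_sqrt_le_mono) simp
      then show "sqrt ?d \<ge> 1000" by simp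
    next
      fix \<mu> :: "real ^ 'd" assume \<mu>: "norm \<mu> \<ge> \<rho>"
      define w where "w = (norm \<mu>)\<^sup>2 * n"
      have w: "C * sqrt (?d * m) \<le> w" using signal[OF \<mu>] 2 by (simp add: w_def min_def)
      \<comment> \<open>Because \<open>m\<close> is below the dimension,
        \<open>sqrt (CARD('d) * m) \<ge> m\<close>; this gives the rescaled signal norm at least
        1.\<close>
      have "real m = sqrt (real m * m)" by simp
      also have "\<dots> \<le> sqrt (?d * m)" using 2 by (intro real_sqrt_le_mono mult_right_mono) auto
      finally have "1 * real m \<le> C * sqrt (?d * m)" using C1 by (intro mult_mono) auto
      then have "w / m \<ge> 1" using w assms(1) by (simp add: field_simps)
      moreover have "10 ^ 10 * L \<le> m * (w / m / sqrt ?d)\<^sup>2"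
      proof -
        have "C * 1 \<le> C * C" using C1 by (intro mult_left_mono) auto
        then have "10 ^ 10 * L \<le> C\<^sup>2" using C_ge_L by (simp add: power2_eq_square)
        \<comment> \<open>The dimension cancels: the shift is at least \<open>C / sqrt m\<close>, so
          \<open>m\<close> times its square is at least \<open>C^2\<close>.\<close>
        also have "\<dots> = m * (C * sqrt (?d * m) / m / sqrt ?d)\<^sup>2"
        proof -
          have "(C * sqrt (?d * m) / m / sqrt ?d)\<^sup>2 = C\<^sup>2 * (?d * m) / (real m)\<^sup>2 / ?d"
            by (simp add: power_mult_distrib power_divide)
          then show ?thesis using assms(1) by (simp add: power2_eq_square)
        qed
        also have "\<dots> \<le> m * (w / m / sqrt ?d)\<^sup>2"
          using w C1 by (intro mult_left_mono power_mono divide_right_mono) auto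
        finally show ?thesis .
      qed
      ultimately show "(norm \<mu>)\<^sup>2 * n / m \<ge> 1 \<and> m * ((norm \<mu>)\<^sup>2 * n / m / sqrt ?d)\<^sup>2 \<ge> 10 ^ 10 * ln (16 / \<alpha>)"
        by (simp add: w_def L_def)
    qed (use 2 in \<open>simp add: L_def\<close>)
  next
    case 3
    show ?thesis
    proof (rule half_space_counting_test[OF assms(1-5)])
      show "real m \<ge> 72 * ln (16 / \<alpha>)"
      proof -
        have "72 * L \<le> 10 ^ 6 * L" using L by simp
        then show ?thesis using 3(1) by (simp add: L_def)
      qed
    next
      fix \<mu> :: "real ^ 'd" assume \<mu>: "norm \<mu> \<ge> \<rho>"
      have "C * ?d \<le> (norm \<mu>)\<^sup>2 * n" using signal[OF \<mu>] 3 by (simp add: min_absorb2)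
      have "4608 * ln (16 / \<alpha>) * ?d \<le> \<alpha>\<^sup>2 * sqrt \<alpha> * C * ?d"
        using C_const_ge_power assms by (intro mult_right_mono) (auto simp: C_def)
      also have "\<dots> = \<alpha>\<^sup>2 * sqrt \<alpha> * (C * ?d)" by (simp only: mult.assoc)
      also have "\<dots> \<le> \<alpha>\<^sup>2 * sqrt \<alpha> * ((norm \<mu>)\<^sup>2 * n)"
        using \<open>C * ?d \<le> (norm \<mu>)\<^sup>2 * n\<close> assms by (intro mult_left_mono) auto
      finally show "4608 * ln (16 / \<alpha>) * ?d \<le> \<alpha>\<^sup>2 * sqrt \<alpha> * ((norm \<mu>)\<^sup>2 * n)" .
    qed
  qed
qed

end
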